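(* Let $T>0$, let $\ell,d\ge 1$ be integers, let $\alpha\in(\tfrac12,1]$ and let $x\in C^\alpha([0,T],\mathbb{R}^\ell)$. Let $\gamma\in(\tfrac1\alpha-1,1)$ and let $F:\mathbb{R}^d\to\mathcal{K}(L(\mathbb{R}^\ell,\mathbb{R}^d))$ be a bounded $\gamma$-Hölder set-valued map with nonempty compact values. Then, for every initial condition $\xi\in\mathbb{R}^d$, the Young differential inclusion $$dz_t\in F(z_t)\,dx_t,\qquad z_0=\xi,$$ has a solution defined over the time interval $[0,T]$.
   Context: $L(\mathbb{R}^\ell,\mathbb{R}^d)$ is the space of linear maps from $\mathbb{R}^\ell$ to $\mathbb{R}^d$, and $\mathcal{K}(S)$ denotes the set of nonempty compact subsets of $S$, endowed with the Hausdorff metric. $F$ is $\gamma$-Hölder if its $\gamma$-Hölder semi-norm $\|F\|_\gamma$ with respect to the Hausdorff metric is finite; $F$ is bounded if $\|F\|_\infty:=\sup\{|w|: w\in F(a),\,a\in\mathbb{R}^d\}<\infty$. $C^\alpha([0,T],\mathbb{R}^\ell)$ is the space of $\alpha$-Hölder continuous paths. A path $v$ on $[0,T]$ (not necessarily continuous) has finite $p$-variation, $p\ge1$, if $\|v\|_{p\text{-var}}^p:=\sup\sum_i|v_{s_{i+1}}-v_{s_i}|^p<\infty$, the supremum being over finite partitions $\{s_i\}$ of $[0,T]$. A solution to the Young differential inclusion $dz_t\in F(z_t)dx_t$, $z_0=\xi$, on $[0,T]$ is a pair of paths $(z,v)$ defined on $[0,T]$ such that: (i) $v$ is an $L(\mathbb{R}^\ell,\mathbb{R}^d)$-valued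 path of finite $p$-variation for some $p\ge1$ with $\alpha+\frac1p>1$; (ii) for all $0\le t\le T$, $$v_t\in F(z_t)\quad\text{and}\quad z_t=\xi+\int_0^t v_s\,dx_s,$$ where the integral is the Young integral, i.e. the limit of the Riemann sums $\sum_i v_{s_i}(x_{s_{i+1}}-x_{s_i})$ as the mesh of the partition $\{s_i\}$ of $[0,t]$ tends to $0$. *)

theory Defs
  imports "HOL-Analysis.Analysis"
begin

text \<open>Intended for nonempty bounded sets, where both suprema are over bounded families;
  on nonempty compact sets it is the Hausdorff metric.\<close>

definition hausdorff_dist :: "'a::metric_space set \<Rightarrow> 'a set \<Rightarrow> real" where
  "hausdorff_dist A B = max (SUP a\<in>A. infdist a B) (SUP b\<in>B. infdist b A)"

text \<open>Finiteness of the Hoelder semi-norm of exponent \<open>\<gamma>\<close> on \<open>S\<close>. The distance \<open>D\<close> on the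
  codomain is a parameter, so that it can be \<^const>\<open>dist\<close> for ordinary paths and
  \<^const>\<open>hausdorff_dist\<close> for set-valued maps.\<close>

definition holder_wrt ::
  "('b \<Rightarrow> 'b \<Rightarrow> real) \<Rightarrow> real \<Rightarrow> 'a::metric_space set \<Rightarrow> ('a \<Rightarrow> 'b) \<Rightarrow> bool" where
  "holder_wrt D \<gamma> S f \<longleftrightarrow>
     bdd_above {D (f a) (f b) / dist a b powr \<gamma> | a b. a \<in> S \<and> b \<in> S \<and> a \<noteq> b}"

text \<open>The points \<open>s 0 < \<dots> < s n\<close>; values of \<open>s\<close> beyond \<open>n\<close> are irrelevant. The degenerate interval
  \<open>a = b\<close> has the single partition with \<open>n = 0\<close>, so an integral over it is zero.\<close>

definition is_partition :: "real \<Rightarrow> real \<Rightarrow> nat \<Rightarrow> (nat \<Rightarrow> real) \<Rightarrow> bool" where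
  "is_partition a b n s \<longleftrightarrow> s 0 = a \<and> s n = b \<and> (\<forall>i<n. s i < s (Suc i))"

definition finite_p_variation ::
  "real \<Rightarrow> real \<Rightarrow> real \<Rightarrow> (real \<Rightarrow> 'a::real_normed_vector) \<Rightarrow> bool" where
  "finite_p_variation p a b v \<longleftrightarrow>
     bdd_above {\<Sum>i<n. norm (v (s (Suc i)) - v (s i)) powr p | n s. is_partition a b n s}"

definition has_young_integral ::
  "(real \<Rightarrow> 'a::real_normed_vector \<Rightarrow>\<^sub>L 'b::real_normed_vector) \<Rightarrow> (real \<Rightarrow> 'a) \<Rightarrow> real \<Rightarrow> real \<Rightarrow> 'b \<Rightarrow> bool"
  where
  "has_young_integral v x a b I \<longleftrightarrow>
     (\<forall>\<epsilon>>0. \<exists>\<delta>>0. \<forall>n s. is_partition a b n s \<and> (\<forall>i<n. s (Suc i) - s i < \<delta>) \<longrightarrow>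
        norm ((\<Sum>i<n. blinfun_apply (v (s i)) (x (s (Suc i)) - x (s i))) - I) < \<epsilon>)"

definition young_inclusion_solution ::
  "real \<Rightarrow> real \<Rightarrow> (real \<Rightarrow> 'a::real_normed_vector) \<Rightarrow>
   ('b::real_normed_vector \<Rightarrow> ('a \<Rightarrow>\<^sub>L 'b) set) \<Rightarrow> 'b \<Rightarrow>
   (real \<Rightarrow> 'b) \<Rightarrow> (real \<Rightarrow> 'a \<Rightarrow>\<^sub>L 'b) \<Rightarrow> bool" where
  "young_inclusion_solution T \<alpha> x F \<xi> z v \<longleftrightarrow>
     (\<exists>p\<ge>1. \<alpha> + 1 / p > 1 \<and> finite_p_variation p 0 T v) \<and>
     (\<forall>t\<in>{0..T}. v t \<in> F (z t) \<and> (\<exists>I. has_young_integral v x 0 t I \<and> z t = \<xi> + I))"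

end

theory Submission
  imports Defs "HOL-Complex_Analysis.Great_Picard"
begin

text \<open>On the grid of step \<open>1 / 2 ^ n\<close> run an Euler scheme in which the new \<open>v\<close> at \<open>j / 2 ^ n\<close> is
  a point of \<open>F\<close> nearest to the value of \<open>v\<close> at the parent of \<open>j / 2 ^ n\<close>, the dyadic point obtained by
  clearing the lowest set bit of \<open>j\<close>. Then \<open>v\<close> is a sum over the dyadic levels \<open>k\<close> of step functions
  of size \<open>O(q ^ k)\<close>, where \<open>h = 2 powr (- \<alpha>)\<close>, \<open>q = h powr \<gamma>\<close>, and the hypothesis
  \<open>\<alpha> (1 + \<gamma>) > 1\<close> says \<open>2 h q < 1\<close>. The increments of \<open>z\<close> over cells of level \<open>k\<close> are \<open>O(h ^ k)\<close>
  uniformly in \<open>n\<close>, and all bounds pass to the limit of a subsequence converging at every dyadic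
  point. A Riemann sum of the level \<open>k\<close> part of \<open>v\<close> is \<open>O((2 h q) ^ k)\<close> uniformly over all
  partitions, so the Young integral may be taken level by level; and \<open>v\<close> has finite
  \<open>p\<close>-variation as soon as \<open>2 q powr p < 1\<close>, which is compatible with \<open>\<alpha> + 1 / p > 1\<close>.\<close>

section \<open>Selections of a Hoelder set-valued map\<close>

text \<open>Compactness enters twice: the distances under the supremum are bounded, so
  \<open>hausdorff_dist\<close> dominates each of them, and a nearest point of \<open>F b\<close>
  exists. The Hoelder quotient says nothing about \<open>a = b\<close>, where \<open>u\<close>
  itself is the witness.\<close>

lemma holder_selection:
  fixes F :: "'b::metric_space \<Rightarrow> 'c::heine_borel set"
  assumes ne: "\<And>a. F a \<noteq> {}" and comp: "\<And>a. compact (F a)"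
    and hol: "holder_wrt hausdorff_dist \<gamma> UNIV F"
  obtains L where "L \<ge> 0"
    "\<And>a b u. u \<in> F a \<Longrightarrow> \<exists>w\<in>F b. dist w u \<le> L * dist a b powr \<gamma>"
proof -
  obtain C where C: "\<And>a b. a \<noteq> b \<Longrightarrow> hausdorff_dist (F a) (F b) / dist a b powr \<gamma> \<le> C"
    using hol unfolding holder_wrt_def bdd_above_def by blast
  have "\<exists>w\<in>F b. dist w u \<le> max C 0 * dist a b powr \<gamma>" if u: "u \<in> F a" for a b u
  proof (cases "a = b")
    case True
    with u show ?thesis by (intro bexI[of _ u]) auto
  next
    case False
    have "bdd_above ((\<lambda>a. infdist a (F b)) ` F a)"
      by (intro bounded_imp_bdd_above compact_imp_bounded compact_continuous_image
          continuous_intros comp)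
    then have "infdist u (F b) \<le> (SUP a\<in>F a. infdist a (F b))"
      by (rule cSUP_upper[OF u])
    also have "\<dots> \<le> hausdorff_dist (F a) (F b)"
      by (simp add: hausdorff_dist_def)
    also have "\<dots> \<le> C * dist a b powr \<gamma>"
      using C[OF False] False by (simp add: divide_le_eq)
    also have "\<dots> \<le> max C 0 * dist a b powr \<gamma>"
      by (intro mult_right_mono) auto
    finally have *: "infdist u (F b) \<le> max C 0 * dist a b powr \<gamma>" .
    obtain w where "w \<in> F b" "infdist u (F b) = dist u w"
      using infdist_attains_inf[OF compact_imp_closed[OF comp] ne] by blast
    with * show ?thesis by (auto simp: dist_commute)
  qed
  then show ?thesis using that[of "max C 0"] by auto
qed

text \<open>Points \<open>w n\<close> of \<open>F b\<close> chosen close to \<open>u n\<close> share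
  the limit \<open>l\<close>, and \<open>F b\<close> is closed. This lets the inclusion survive the
  limit of the Euler schemes.\<close>

lemma selection_closed_graph:
  fixes F :: "'b::metric_space \<Rightarrow> 'c::metric_space set"
  assumes sel: "\<And>a b u. u \<in> F a \<Longrightarrow> \<exists>w\<in>F b. dist w u \<le> L * dist a b powr \<gamma>"
    and "\<gamma> > 0" and cl: "closed (F b)"
    and mem: "\<And>n. u n \<in> F (y n)" and y: "y \<longlonglongrightarrow> b" and u: "u \<longlonglongrightarrow> l"
  shows "l \<in> F b"
proof -
  have "\<forall>n. \<exists>w. w \<in> F b \<and> dist w (u n) \<le> L * dist (y n) b powr \<gamma>"
    using sel[OF mem] by blast
  then obtain w where w: "\<And>n. w n \<in> F b" "\<And>n. dist (w n) (u n) \<le> L * dist (y n) b powr \<gamma>"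
    by metis
  have "(\<lambda>n. dist (y n) b) \<longlonglongrightarrow> 0"
    using y tendsto_dist_iff by blast
  then have "(\<lambda>n. dist (y n) b powr \<gamma>) \<longlonglongrightarrow> 0"
    by (intro tendsto_zero_powrI[where b = \<gamma>]) (auto simp: \<open>\<gamma> > 0\<close>)
  then have "(\<lambda>n. L * dist (y n) b powr \<gamma>) \<longlonglongrightarrow> 0"
    by (rule tendsto_mult_right_zero)
  then have lim: "(\<lambda>n. L * dist (y n) b powr \<gamma> + dist (u n) l) \<longlonglongrightarrow> 0"
    using u tendsto_dist_iff by (intro tendsto_add_zero) blast+
  have "norm (dist (w n) l) \<le> L * dist (y n) b powr \<gamma> + dist (u n) l" for n
    using w(2)[of n] dist_triangle[of "w n" l "u n"] by simp
  then have "(\<lambda>n. dist (w n) l) \<longlonglongrightarrow> 0"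
    by (intro Lim_null_comparison[OF _ lim]) simp
  then have "w \<longlonglongrightarrow> l" using tendsto_dist_iff by blast
  then show ?thesis
    using closed_sequentially[OF cl] w(1) by blast
qed

section \<open>Functions on dyadic points\<close>

definition dyadic_index :: "nat \<Rightarrow> real \<Rightarrow> nat" where
  "dyadic_index k t = nat \<lfloor>2 ^ k * t\<rfloor>"

lemma dyadic_index_le: "0 \<le> t \<Longrightarrow> real (dyadic_index k t) \<le> 2 ^ k * t"
  by (simp add: dyadic_index_def)

lemma dyadic_index_gt: "2 ^ k * t < real (dyadic_index k t) + 1"
  unfolding dyadic_index_def by linarith

lemma dyadic_index_mono: "s \<le> t \<Longrightarrow> dyadic_index k s \<le> dyadic_index k t"
  unfolding dyadic_index_def by (intro nat_mono floor_mono mult_left_mono) auto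

lemma less_dyadic_index_iff:
  assumes "0 \<le> t" shows "dyadic_index k t < j \<longleftrightarrow> t < real j / 2 ^ k"
proof -
  have "dyadic_index k t < j \<longleftrightarrow> 2 ^ k * t < real j"
    using assms unfolding dyadic_index_def by (simp add: nat_less_iff floor_less_iff)
  then show ?thesis by (simp add: field_simps)
qed

lemma dyadic_index_Suc_div_2: "0 \<le> t \<Longrightarrow> dyadic_index (Suc k) t div 2 = dyadic_index k t"
proof -
  assume t: "0 \<le> t"
  have "\<lfloor>2 ^ Suc k * t\<rfloor> div 2 = \<lfloor>2 ^ k * t\<rfloor>"
    using floor_divide_real_eq_div[of 2 "2 ^ Suc k * t"] by simp
  then show ?thesis
    using t by (simp add: dyadic_index_def nat_div_distrib[symmetric])
qed

lemma dyadic_index_separates: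
  assumes "0 \<le> s" "s < t"
  obtains k where "dyadic_index k s \<noteq> dyadic_index k t"
proof -
  obtain k where k: "1 / (t - s) < 2 ^ k"
    using real_arch_pow[of 2 "1 / (t - s)"] by auto
  then have "1 < 2 ^ k * (t - s)" using assms by (simp add: field_simps)
  moreover have "dyadic_index k s \<noteq> dyadic_index k t"
    using dyadic_index_le[of s k] dyadic_index_gt[of k t] assms calculation
    by (auto simp: algebra_simps)
  ultimately show ?thesis using that by blast
qed

text \<open>A value \<open>u k j\<close> is attached to the dyadic point \<open>j / 2 ^ k\<close>; the parent of \<open>j / 2 ^ Suc k\<close> is
  its round-down to level \<open>k\<close>.\<close>

definition dyadic_tree :: "real \<Rightarrow> real \<Rightarrow> (nat \<Rightarrow> nat \<Rightarrow> 'a::real_normed_vector) \<Rightarrow> bool" where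
  "dyadic_tree D q u \<longleftrightarrow> (\<forall>k j. norm (u (Suc k) j - u k (j div 2)) \<le> D * q ^ k)"

text \<open>By \<open>dyadic_index_Suc_div_2\<close> the sampled values run down one branch of the
  tree. They converge if \<open>dyadic_tree D q u\<close>, \<open>0 \<le> q < 1\<close> and
  \<open>0 \<le> t\<close> in a complete space; outside that case \<open>lim\<close> may be an
  arbitrary value.\<close>

definition tree_limit :: "(nat \<Rightarrow> nat \<Rightarrow> 'a::real_normed_vector) \<Rightarrow> real \<Rightarrow> 'a" where
  "tree_limit u t = lim (\<lambda>k. u k (dyadic_index k t))"

lemma geometric_increments_dist:
  fixes a :: "nat \<Rightarrow> 'a::real_normed_vector"
  assumes a: "\<And>m. norm (a (Suc m) - a m) \<le> C * q ^ m" and q: "0 \<le> q" "q < 1" and "k \<le> m"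
  shows "norm (a m - a k) \<le> C / (1 - q) * q ^ k"
proof -
  have C: "0 \<le> C"
    using order_trans[OF norm_ge_zero a[of 0]] by simp
  \<comment> \<open>The subtracted \<open>q ^ m\<close> is the tail not yet summed; keeping it makes
    the induction close exactly.\<close>
  have "norm (a m - a k) \<le> C / (1 - q) * (q ^ k - q ^ m)"
    using \<open>k \<le> m\<close>
  proof (induction m rule: dec_induct)
    case (step m)
    have "norm (a (Suc m) - a k) \<le> C * q ^ m + C / (1 - q) * (q ^ k - q ^ m)"
      using step.IH a[of m] norm_triangle_ineq[of "a (Suc m) - a m" "a m - a k"] by simp
    also have "\<dots> = C / (1 - q) * (q ^ k - q ^ Suc m)"
      using q by (simp add: field_simps)
    finally show ?case .
  qed simp
  also have "\<dots> \<le> C / (1 - q) * q ^ k"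
    using C q by (intro mult_left_mono) auto
  finally show ?thesis .
qed

lemma geometric_increments_limit_dist:
  fixes a :: "nat \<Rightarrow> 'a::real_normed_vector"
  assumes a: "\<And>m. norm (a (Suc m) - a m) \<le> C * q ^ m" and q: "0 \<le> q" "q < 1"
    and lim: "a \<longlonglongrightarrow> l"
  shows "norm (l - a k) \<le> C / (1 - q) * q ^ k"
proof -
  have "(\<lambda>m. norm (a m - a k)) \<longlonglongrightarrow> norm (l - a k)"
    by (intro tendsto_intros lim)
  then show ?thesis
    by (rule Lim_bounded[where M = k]) (use geometric_increments_dist[OF a q] in auto)
qed

lemma dyadic_tree_increment:
  assumes "dyadic_tree D q u" "0 \<le> t"
  shows "norm (u (Suc m) (dyadic_index (Suc m) t) - u m (dyadic_index m t)) \<le> D * q ^ m"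
  using assms dyadic_index_Suc_div_2[of t m] unfolding dyadic_tree_def by metis

lemma dyadic_tree_dist:
  assumes u: "dyadic_tree D q u" and q: "0 \<le> q" "q < 1" and t: "0 \<le> t" and "k \<le> m"
  shows "norm (u m (dyadic_index m t) - u k (dyadic_index k t)) \<le> D / (1 - q) * q ^ k"
  using geometric_increments_dist[OF dyadic_tree_increment[OF u t] q \<open>k \<le> m\<close>] .

lemma
  fixes u :: "nat \<Rightarrow> nat \<Rightarrow> 'a::banach"
  assumes u: "dyadic_tree D q u" and q: "0 \<le> q" "q < 1" and t: "0 \<le> t"
  shows tendsto_tree_limit: "(\<lambda>k. u k (dyadic_index k t)) \<longlonglongrightarrow> tree_limit u t" (is ?lim)
    and tree_limit_dist: "norm (tree_limit u t - u k (dyadic_index k t)) \<le> D / (1 - q) * q ^ k" (is ?dist)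
proof -
  have lim0: "(\<lambda>k. D / (1 - q) * q ^ k) \<longlonglongrightarrow> 0"
    using q by (intro tendsto_mult_right_zero LIMSEQ_power_zero) auto
  have "Cauchy (\<lambda>k. u k (dyadic_index k t))"
  proof (rule CauchyI)
    fix e :: real assume "0 < e"
    then obtain N where N: "D / (1 - q) * q ^ N < e / 2"
      using order_tendstoD(2)[OF lim0, of "e / 2"] by (auto simp: eventually_sequentially)
    have "norm (u m (dyadic_index m t) - u n (dyadic_index n t)) < e" if "m \<ge> N" "n \<ge> N" for m n
    proof -
      have "norm (u m (dyadic_index m t) - u n (dyadic_index n t))
        \<le> norm (u m (dyadic_index m t) - u N (dyadic_index N t))
          + norm (u n (dyadic_index n t) - u N (dyadic_index N t))"
        by norm
      then show ?thesis
        using dyadic_tree_dist[OF u q t that(1)] dyadic_tree_dist[OF u q t that(2)] N by linarith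
    qed
    then show "\<exists>M. \<forall>m\<ge>M. \<forall>n\<ge>M. norm (u m (dyadic_index m t) - u n (dyadic_index n t)) < e"
      by blast
  qed
  then show lim: ?lim
    unfolding tree_limit_def using Cauchy_convergent convergent_LIMSEQ_iff by blast
  show ?dist
    by (rule geometric_increments_limit_dist[OF dyadic_tree_increment[OF u t] q lim])
qed

text \<open>The tree bound is uniform in \<open>n\<close>, so the growing level \<open>r n\<close>
  can be replaced by a fixed level \<open>k\<close> before \<open>n\<close> grows. The level moves
  because \<open>euler_dyadic_trees\<close> states the inclusion at level \<open>n\<close> of the
  \<open>n\<close>-th tree.\<close>

lemma tendsto_tree_limit_diagonal:
  fixes u :: "nat \<Rightarrow> nat \<Rightarrow> nat \<Rightarrow> 'a::banach"
  assumes un: "\<And>n. dyadic_tree D q (u n)" and u: "dyadic_tree D q w" and q: "0 \<le> q" "q < 1"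
    and t: "0 \<le> t" and lim: "\<And>k j. (\<lambda>n. u n k j) \<longlonglongrightarrow> w k j"
    and r: "filterlim r at_top sequentially"
  shows "(\<lambda>n. u n (r n) (dyadic_index (r n) t)) \<longlonglongrightarrow> tree_limit w t"
proof (rule LIMSEQ_I)
  fix e :: real assume "0 < e"
  have "(\<lambda>k. D / (1 - q) * q ^ k) \<longlonglongrightarrow> 0"
    using q by (intro tendsto_mult_right_zero LIMSEQ_power_zero) auto
  from order_tendstoD(2)[OF this, of "e / 3"] \<open>0 < e\<close>
  obtain k where k: "D / (1 - q) * q ^ k < e / 3"
    by (auto simp: eventually_sequentially)
  have "\<forall>\<^sub>F n in sequentially. r n \<ge> k"
    using r by (simp add: filterlim_at_top)
  moreover have "\<forall>\<^sub>F n in sequentially. norm (u n k (dyadic_index k t) - w k (dyadic_index k t)) < e / 3"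
    using tendstoD[OF lim, of "e / 3" k "dyadic_index k t"] \<open>0 < e\<close> by (simp add: dist_norm)
  ultimately have "\<forall>\<^sub>F n in sequentially. norm (u n (r n) (dyadic_index (r n) t) - tree_limit w t) < e"
  proof eventually_elim
    case (elim n)
    have "norm (u n (r n) (dyadic_index (r n) t) - tree_limit w t) \<le>
      norm (u n (r n) (dyadic_index (r n) t) - u n k (dyadic_index k t))
      + norm (u n k (dyadic_index k t) - w k (dyadic_index k t))
      + norm (tree_limit w t - w k (dyadic_index k t))"
      by norm
    then show ?case
      using elim k dyadic_tree_dist[OF un[of n] q t elim(1)] tree_limit_dist[OF u q t, of k]
      by linarith
  qed
  then show "\<exists>N. \<forall>n\<ge>N. norm (u n (r n) (dyadic_index (r n) t) - tree_limit w t) < e"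
    by (simp add: eventually_sequentially)
qed

lemma dyadic_tree_limit_point:
  assumes "\<And>n. dyadic_tree D q (u n)" "\<And>k j. (\<lambda>n. u n k j) \<longlonglongrightarrow> w k j"
  shows "dyadic_tree D q w"
  unfolding dyadic_tree_def
proof (intro allI)
  fix k j
  have "(\<lambda>n. norm (u n (Suc k) j - u n k (j div 2))) \<longlonglongrightarrow> norm (w (Suc k) j - w k (j div 2))"
    by (intro tendsto_intros assms)
  then show "norm (w (Suc k) j - w k (j div 2)) \<le> D * q ^ k"
    by (rule Lim_bounded[where M = 0]) (use assms(1) in \<open>auto simp: dyadic_tree_def\<close>)
qed

section \<open>Riemann sums along dyadic step functions\<close>

lemma is_partition_mono:
  assumes "is_partition a b n s" "i \<le> j" "j \<le> n"
  shows "s i \<le> s j"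
  using assms(2,3)
proof (induction j rule: dec_induct)
  case (step j)
  then show ?case
    using assms(1) by (force simp: is_partition_def Suc_le_eq)
qed simp

lemma is_partition_bounds:
  assumes "is_partition a b n s" "i \<le> n"
  shows "a \<le> s i" "s i \<le> b"
  using is_partition_mono[OF assms(1), of 0 i] is_partition_mono[OF assms(1), of i n] assms
  by (auto simp: is_partition_def)

text \<open>The partition intervals that start in the cell \<open>[j / 2 ^ k, (j + 1) / 2 ^ k)\<close> telescope to the
  interval between the entries of cells \<open>j\<close> and \<open>Suc j\<close>.\<close>

definition dyadic_entry :: "nat \<Rightarrow> (nat \<Rightarrow> real) \<Rightarrow> nat \<Rightarrow> nat \<Rightarrow> real" where
  "dyadic_entry n s k j = s (LEAST i. n \<le> i \<or> real j / 2 ^ k \<le> s i)"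

lemma
  fixes x :: "real \<Rightarrow> 'a::real_normed_vector" and f :: "nat \<Rightarrow> 'a \<Rightarrow>\<^sub>L 'b::real_normed_vector"
  assumes P: "is_partition 0 t n s"
  shows dyadic_entry_0: "dyadic_entry n s k 0 = 0"
    and dyadic_entry_last: "dyadic_entry n s k (Suc (dyadic_index k t)) = t"
    and dyadic_entry_mono: "dyadic_entry n s k j \<le> dyadic_entry n s k (Suc j)"
    and dyadic_entry_le: "dyadic_entry n s k j \<le> t"
    and dyadic_entry_ge: "j \<le> dyadic_index k t \<Longrightarrow> real j / 2 ^ k \<le> dyadic_entry n s k j"
    and dyadic_entry_le_mesh: "\<delta> \<ge> 0 \<Longrightarrow> \<forall>i<n. s (Suc i) - s i < \<delta> \<Longrightarrow> dyadic_entry n s k j \<le> real j / 2 ^ k + \<delta>"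
    and riemann_sum_dyadic_step:
      "(\<Sum>i<n. blinfun_apply (f (dyadic_index k (s i))) (x (s (Suc i)) - x (s i)))
       = (\<Sum>j<Suc (dyadic_index k t). blinfun_apply (f j) (x (dyadic_entry n s k (Suc j)) - x (dyadic_entry n s k j)))"
proof -
  have s0: "s 0 = 0" and sn: "s n = t"
    using P by (auto simp: is_partition_def)
  have t: "0 \<le> t" using is_partition_bounds[OF P, of 0] sn s0 by auto
  \<comment> \<open>The alternative \<open>n \<le> i\<close> makes the least index exist, with value
    \<open>n\<close> when no earlier point reaches the cell.\<close>
  define e where "e j = (LEAST i. n \<le> i \<or> real j / 2 ^ k \<le> s i)" for j
  have e_le: "e j \<le> n" for j
    unfolding e_def by (rule Least_le) simp
  have e_cond: "n \<le> e j \<or> real j / 2 ^ k \<le> s (e j)" for j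
    unfolding e_def by (rule LeastI[of _ n]) simp
  have e_min: "i < n \<and> s i < real j / 2 ^ k" if "i < e j" for i j
    using not_less_Least[OF that[unfolded e_def]] by auto
  have e_mono: "e j \<le> e (Suc j)" for j
  proof -
    have "real j / 2 ^ k \<le> real (Suc j) / 2 ^ k" by (simp add: divide_right_mono)
    then have "n \<le> e (Suc j) \<or> real j / 2 ^ k \<le> s (e (Suc j))"
      using e_cond[of "Suc j"] by linarith
    then show ?thesis unfolding e_def[of j] by (rule Least_le)
  qed
  have e0: "e 0 = 0"
    unfolding e_def by (rule Least_equality) (auto simp: s0)
  have eN: "e (Suc (dyadic_index k t)) = n"
  proof (rule ccontr)
    assume "e (Suc (dyadic_index k t)) \<noteq> n"
    then have "real (Suc (dyadic_index k t)) / 2 ^ k \<le> t"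
      using e_cond[of "Suc (dyadic_index k t)"] e_le[of "Suc (dyadic_index k t)"]
        is_partition_bounds(2)[OF P e_le[of "Suc (dyadic_index k t)"]] by linarith
    then show False
      using less_dyadic_index_iff[OF t, of k "Suc (dyadic_index k t)"] by simp
  qed
  have idx: "dyadic_index k (s i) = j" if "e j \<le> i" "i < e (Suc j)" for i j
  proof -
    have i: "i < n" "s i < real (Suc j) / 2 ^ k" using e_min[OF that(2)] by auto
    then have "real j / 2 ^ k \<le> s (e j)" using e_cond[of j] that(1) by linarith
    also have "\<dots> \<le> s i" using is_partition_mono[OF P that(1)] i by simp
    finally have "\<not> s i < real j / 2 ^ k" by simp
    moreover have "0 \<le> s i" using is_partition_bounds[OF P, of i] i by simp
    ultimately have "\<not> dyadic_index k (s i) < j" "dyadic_index k (s i) < Suc j"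
      using i(2) less_dyadic_index_iff by blast+
    then show ?thesis by linarith
  qed
  have entry: "dyadic_entry n s k j = s (e j)" for j
    by (simp add: dyadic_entry_def e_def)
  show "dyadic_entry n s k 0 = 0" by (simp add: entry e0 s0)
  show "dyadic_entry n s k (Suc (dyadic_index k t)) = t" by (simp add: entry eN sn)
  show "dyadic_entry n s k j \<le> dyadic_entry n s k (Suc j)"
    unfolding entry by (rule is_partition_mono[OF P e_mono e_le])
  show "dyadic_entry n s k j \<le> t"
    unfolding entry by (rule is_partition_bounds(2)[OF P e_le])
  show "real j / 2 ^ k \<le> dyadic_entry n s k j" if "j \<le> dyadic_index k t"
  proof (cases "n \<le> e j")
    case True
    then have "s (e j) = t" using e_le[of j] sn by simp
    with that less_dyadic_index_iff[OF t, of k j] show ?thesis by (auto simp: entry)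
  qed (use e_cond[of j] in \<open>auto simp: entry\<close>)
  \<comment> \<open>The partition point just before the entry still lies left of
    \<open>j / 2 ^ k\<close>, so the overshoot is at most one mesh width.\<close>
  show "dyadic_entry n s k j \<le> real j / 2 ^ k + \<delta>" if "\<delta> \<ge> 0" "\<forall>i<n. s (Suc i) - s i < \<delta>"
  proof (cases "e j")
    case 0
    then show ?thesis using that s0 by (simp add: entry)
  next
    case (Suc i)
    then show ?thesis using e_min[of i j] that by (force simp: entry less_diff_eq)
  qed
  define g where "g i = blinfun_apply (f (dyadic_index k (s i))) (x (s (Suc i)) - x (s i))" for i
  have split: "(\<Sum>i<e m. g i) = (\<Sum>j<m. \<Sum>i\<in>{e j..<e (Suc j)}. g i)" for m
  proof (induction m)
    case (Suc m)
    have "(\<Sum>i<e (Suc m). g i) = (\<Sum>i<e m. g i) + (\<Sum>i\<in>{e m..<e (Suc m)}. g i)"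
      using sum.atLeastLessThan_concat[of 0 "e m" "e (Suc m)" g] e_mono[of m]
      by (simp add: atLeast0LessThan)
    with Suc show ?case by simp
  qed (simp add: e0)
  have cell: "(\<Sum>i\<in>{e j..<e (Suc j)}. g i) = blinfun_apply (f j) (x (s (e (Suc j))) - x (s (e j)))" for j
  proof -
    have "(\<Sum>i\<in>{e j..<e (Suc j)}. g i) = (\<Sum>i\<in>{e j..<e (Suc j)}. blinfun_apply (f j) (x (s (Suc i)) - x (s i)))"
      by (rule sum.cong) (auto simp: g_def idx)
    also have "\<dots> = blinfun_apply (f j) (\<Sum>i\<in>{e j..<e (Suc j)}. x (s (Suc i)) - x (s i))"
      by (simp add: blinfun.sum_right)
    finally show ?thesis
      using sum_Suc_diff'[OF e_mono[of j], of "\<lambda>i. x (s i)"] by simp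
  qed
  show "(\<Sum>i<n. blinfun_apply (f (dyadic_index k (s i))) (x (s (Suc i)) - x (s i)))
     = (\<Sum>j<Suc (dyadic_index k t). blinfun_apply (f j) (x (dyadic_entry n s k (Suc j)) - x (dyadic_entry n s k j)))"
    using split[of "Suc (dyadic_index k t)"] unfolding cell eN entry by (simp only: g_def)
qed

text \<open>Below \<open>\<epsilon>\<close> the first term dominates; above it
  \<open>y powr (\<alpha> - 1)\<close> is at most its value at \<open>\<epsilon>\<close>. Being
  affine in \<open>y\<close>, the bound sums to a count of increments plus their total length,
  however uneven they are.\<close>

lemma powr_le_affine:
  fixes y \<epsilon> \<alpha> :: real
  assumes "0 \<le> y" "0 < \<epsilon>" "0 \<le> \<alpha>" "\<alpha> \<le> 1"
  shows "y powr \<alpha> \<le> \<epsilon> powr \<alpha> + \<epsilon> powr (\<alpha> - 1) * y"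
proof (cases "y \<le> \<epsilon>")
  case True
  then have "y powr \<alpha> \<le> \<epsilon> powr \<alpha>" using assms by (intro powr_mono2) auto
  moreover have "0 \<le> \<epsilon> powr (\<alpha> - 1) * y" using assms by simp
  ultimately show ?thesis by linarith
next
  case False
  have "y powr \<alpha> = y powr (\<alpha> - 1) * y"
    using False assms by (simp add: powr_diff)
  also have "\<dots> \<le> \<epsilon> powr (\<alpha> - 1) * y"
    using False assms by (intro mult_right_mono powr_mono2') auto
  finally show ?thesis by (smt (verit) powr_ge_zero)
qed

lemma half_power_powr: "(1 / 2 ^ k) powr \<alpha> = ((1 / 2) powr \<alpha>) ^ k" for \<alpha> :: real
proof -
  have "1 / 2 ^ k = (1 / 2 :: real) powr real k"
    by (simp add: powr_realpow power_one_over)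
  then show ?thesis
    by (simp add: powr_powr powr_power mult.commute)
qed

lemma half_power_powr_minus_1: "(1 / 2 ^ k) powr (\<alpha> - 1) = ((1 / 2) powr \<alpha>) ^ k * 2 ^ k" for \<alpha> :: real
  by (simp add: powr_diff half_power_powr)

text \<open>This is \<open>powr_le_affine\<close> at the cell width \<open>1 / 2 ^ k\<close>, where
  both terms balance if \<open>N\<close> is of order \<open>2 ^ k\<close> and the total length is
  bounded.\<close>

lemma sum_powr_increments_le:
  fixes c :: "nat \<Rightarrow> real"
  assumes c: "\<And>j. c j \<le> c (Suc j)" and \<alpha>: "0 \<le> \<alpha>" "\<alpha> \<le> 1"
  shows "(\<Sum>j<N. (c (Suc j) - c j) powr \<alpha>) \<le> ((1 / 2) powr \<alpha>) ^ k * (real N + 2 ^ k * (c N - c 0))"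
proof -
  have "(\<Sum>j<N. (c (Suc j) - c j) powr \<alpha>)
    \<le> (\<Sum>j<N. (1 / 2 ^ k) powr \<alpha> + (1 / 2 ^ k) powr (\<alpha> - 1) * (c (Suc j) - c j))"
    using c \<alpha> by (intro sum_mono powr_le_affine) auto
  also have "\<dots> = real N * (1 / 2 ^ k) powr \<alpha> + (1 / 2 ^ k) powr (\<alpha> - 1) * (c N - c 0)"
    by (simp add: sum.distrib sum_distrib_left[symmetric] sum_lessThan_telescope)
  finally show ?thesis
    unfolding half_power_powr_minus_1 unfolding half_power_powr by (simp add: algebra_simps)
qed

text \<open>The terms starting in one cell telescope to a single one, leaving at most
  \<open>2 ^ k * t + 1\<close> terms. Their sizes may vary, so they are summed by
  \<open>sum_powr_increments_le\<close>; the bound does not involve the partition.\<close>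

lemma riemann_sum_detail_le:
  fixes x :: "real \<Rightarrow> 'a::real_normed_vector" and f :: "nat \<Rightarrow> 'a \<Rightarrow>\<^sub>L 'b::real_normed_vector"
  assumes P: "is_partition 0 t n s" and f: "\<And>j. norm (f j) \<le> B"
    and x: "\<And>s t. norm (x t - x s) \<le> X * \<bar>t - s\<bar> powr \<alpha>"
    and \<alpha>: "0 \<le> \<alpha>" "\<alpha> \<le> 1" and X: "0 \<le> X"
  shows "norm (\<Sum>i<n. blinfun_apply (f (dyadic_index k (s i))) (x (s (Suc i)) - x (s i)))
     \<le> B * X * (2 * t + 1) * (2 * (1 / 2) powr \<alpha>) ^ k"
proof -
  have t: "0 \<le> t" using is_partition_bounds[OF P, of n] by simp
  have B: "0 \<le> B" using f[of 0] norm_ge_zero order_trans by blast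
  define N where "N = Suc (dyadic_index k t)"
  define c where "c = dyadic_entry n s k"
  have c: "c 0 = 0" "c N = t" "\<And>j. c j \<le> c (Suc j)"
    using dyadic_entry_0[OF P] dyadic_entry_last[OF P] dyadic_entry_mono[OF P]
    by (simp_all add: N_def c_def)
  note eq = riemann_sum_dyadic_step[OF P, of f k x, folded N_def c_def]
  have "norm (\<Sum>j<N. blinfun_apply (f j) (x (c (Suc j)) - x (c j)))
     \<le> (\<Sum>j<N. B * (X * (c (Suc j) - c j) powr \<alpha>))"
  proof (rule sum_norm_le)
    fix j
    have "norm (blinfun_apply (f j) (x (c (Suc j)) - x (c j))) \<le> norm (f j) * norm (x (c (Suc j)) - x (c j))"
      by (rule norm_blinfun)
    also have "\<dots> \<le> B * (X * (c (Suc j) - c j) powr \<alpha>)"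
      using x[of "c (Suc j)" "c j"] c(3)[of j] B by (intro mult_mono f) auto
    finally show "norm (blinfun_apply (f j) (x (c (Suc j)) - x (c j))) \<le> \<dots>" .
  qed
  also have "\<dots> = B * X * (\<Sum>j<N. (c (Suc j) - c j) powr \<alpha>)"
    by (simp add: sum_distrib_left mult.assoc)
  also have "\<dots> \<le> B * X * (((1 / 2) powr \<alpha>) ^ k * (real N + 2 ^ k * (c N - c 0)))"
    using B X by (intro mult_left_mono sum_powr_increments_le c(3) \<alpha>) auto
  also have "\<dots> \<le> B * X * (((1 / 2) powr \<alpha>) ^ k * (2 ^ k * (2 * t + 1)))"
  proof (intro mult_left_mono)
    have "real N \<le> 2 ^ k * t + 1" using dyadic_index_le[OF t, of k] by (simp add: N_def)
    then show "real N + 2 ^ k * (c N - c 0) \<le> 2 ^ k * (2 * t + 1)"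
      using one_le_power[of "2::real" k] unfolding c by (simp only: algebra_simps) linarith
  qed (use B X in auto)
  finally show ?thesis
    unfolding eq by (simp add: power_mult_distrib mult_ac)
qed

text \<open>At a fixed level, moving the entries to their grid points costs
  \<open>\<delta> powr \<alpha>\<close> per cell, up to a constant. The last cell, which contains
  \<open>t\<close>, has no counterpart in the grid sum; its cost vanishes as \<open>k\<close> grows
  rather than with the mesh.\<close>

lemma riemann_sum_dyadic_step_grid_dist:
  fixes x :: "real \<Rightarrow> 'a::real_normed_vector" and f :: "nat \<Rightarrow> 'a \<Rightarrow>\<^sub>L 'b::real_normed_vector"
  assumes P: "is_partition 0 t n s" and mesh: "\<forall>i<n. s (Suc i) - s i < \<delta>" and \<delta>: "0 \<le> \<delta>"
    and f: "\<And>j. norm (f j) \<le> M"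
    and x: "\<And>s t. norm (x t - x s) \<le> X * \<bar>t - s\<bar> powr \<alpha>"
    and \<alpha>: "0 \<le> \<alpha>" and X: "0 \<le> X"
  shows "norm ((\<Sum>i<n. blinfun_apply (f (dyadic_index k (s i))) (x (s (Suc i)) - x (s i)))
      - (\<Sum>j<dyadic_index k t. blinfun_apply (f j) (x (real (Suc j) / 2 ^ k) - x (real j / 2 ^ k))))
     \<le> real (dyadic_index k t) * (2 * M * X) * \<delta> powr \<alpha> + M * X * ((1 / 2) powr \<alpha>) ^ k"
proof -
  have t: "0 \<le> t" using is_partition_bounds[OF P, of n] by simp
  have M: "0 \<le> M" using f[of 0] norm_ge_zero order_trans by blast
  define N where "N = dyadic_index k t"
  define g where "g j = real j / 2 ^ k" for j
  define c where "c = dyadic_entry n s k"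
  have c: "c (Suc N) = t" "\<And>j. c j \<le> t" "\<And>j. j \<le> N \<Longrightarrow> g j \<le> c j" "\<And>j. c j \<le> g j + \<delta>"
    using dyadic_entry_last[OF P] dyadic_entry_le[OF P] dyadic_entry_ge[OF P]
      dyadic_entry_le_mesh[OF P \<delta> mesh]
    by (simp_all add: N_def c_def g_def)
  note eq = riemann_sum_dyadic_step[OF P, of f k x, folded N_def c_def]
  have near: "norm (x (c j) - x (g j)) \<le> X * \<delta> powr \<alpha>" if "j \<le> N" for j
  proof -
    have "\<bar>c j - g j\<bar> powr \<alpha> \<le> \<delta> powr \<alpha>"
      using c(3)[OF that] c(4)[of j] \<alpha> by (intro powr_mono2) auto
    then show ?thesis
      using x[of "c j" "g j"] X by (meson mult_left_mono order_trans)
  qed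
  have "norm (x t - x (c N)) \<le> X * \<bar>t - c N\<bar> powr \<alpha>" by (rule x)
  also have "\<dots> \<le> X * (1 / 2 ^ k) powr \<alpha>"
  proof (intro mult_left_mono powr_mono2)
    have "t < g (Suc N)"
      using less_dyadic_index_iff[OF t, of k "Suc N"] by (simp add: N_def g_def)
    then show "\<bar>t - c N\<bar> \<le> 1 / 2 ^ k"
      using c(2)[of N] c(3)[of N] by (simp add: g_def field_simps)
  qed (use \<alpha> X in auto)
  finally have last: "norm (x t - x (c N)) \<le> X * ((1 / 2) powr \<alpha>) ^ k"
    by (simp add: half_power_powr)
  have "norm (\<Sum>j<N. blinfun_apply (f j) ((x (c (Suc j)) - x (g (Suc j))) - (x (c j) - x (g j))))
     \<le> (\<Sum>j<N. M * (2 * X * \<delta> powr \<alpha>))"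
  proof (rule sum_norm_le)
    fix j assume "j \<in> {..<N}"
    then have "norm ((x (c (Suc j)) - x (g (Suc j))) - (x (c j) - x (g j))) \<le> 2 * X * \<delta> powr \<alpha>"
      using near[of j] near[of "Suc j"] norm_triangle_ineq4[of "x (c (Suc j)) - x (g (Suc j))" "x (c j) - x (g j)"]
      by simp
    then have "norm (f j) * norm ((x (c (Suc j)) - x (g (Suc j))) - (x (c j) - x (g j))) \<le> M * (2 * X * \<delta> powr \<alpha>)"
      using M by (intro mult_mono f) auto
    then show "norm (blinfun_apply (f j) ((x (c (Suc j)) - x (g (Suc j))) - (x (c j) - x (g j)))) \<le> M * (2 * X * \<delta> powr \<alpha>)"
      using norm_blinfun order_trans by blast
  qed
  moreover have "norm (blinfun_apply (f N) (x t - x (c N))) \<le> M * (X * ((1 / 2) powr \<alpha>) ^ k)"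
    using norm_blinfun[of "f N" "x t - x (c N)"] mult_mono[OF f[of N] last M norm_ge_zero] by linarith
  moreover have "(\<Sum>j<Suc N. blinfun_apply (f j) (x (c (Suc j)) - x (c j)))
      - (\<Sum>j<N. blinfun_apply (f j) (x (g (Suc j)) - x (g j)))
    = (\<Sum>j<N. blinfun_apply (f j) ((x (c (Suc j)) - x (g (Suc j))) - (x (c j) - x (g j))))
      + blinfun_apply (f N) (x t - x (c N))"
    by (simp add: c(1) blinfun.diff_right sum_subtractf)
  ultimately show ?thesis
    unfolding eq N_def[symmetric] g_def[symmetric]
    by (simp add: norm_triangle_le mult_ac)
qed

text \<open>Passing from level \<open>m\<close> to \<open>Suc m\<close> changes the integrand by a
  step function of size \<open>D * q ^ m\<close>. The factor \<open>(2 * h) ^ Suc m\<close> lost in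
  \<open>riemann_sum_detail_le\<close> is beaten by \<open>q ^ m\<close>, and the resulting
  geometric series is uniform over partitions.\<close>

lemma riemann_sum_tree_limit_dist:
  fixes x :: "real \<Rightarrow> 'a::real_normed_vector" and w :: "nat \<Rightarrow> nat \<Rightarrow> 'a \<Rightarrow>\<^sub>L 'b::banach"
  assumes P: "is_partition 0 t n s" and w: "dyadic_tree D q w" and q: "0 \<le> q" "q < 1"
    and x: "\<And>s t. norm (x t - x s) \<le> X * \<bar>t - s\<bar> powr \<alpha>"
    and \<alpha>: "0 \<le> \<alpha>" "\<alpha> \<le> 1" and X: "0 \<le> X" and h: "h = (1 / 2) powr \<alpha>" and rate: "2 * h * q < 1"
  shows "norm ((\<Sum>i<n. blinfun_apply (tree_limit w (s i)) (x (s (Suc i)) - x (s i)))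
       - (\<Sum>i<n. blinfun_apply (w k (dyadic_index k (s i))) (x (s (Suc i)) - x (s i))))
     \<le> (D * X * (2 * t + 1) * (2 * h)) / (1 - 2 * h * q) * (2 * h * q) ^ k"
proof (rule geometric_increments_limit_dist)
  have s: "0 \<le> s i" if "i < n" for i using is_partition_bounds[OF P, of i] that by simp
  show "(\<lambda>k. \<Sum>i<n. blinfun_apply (w k (dyadic_index k (s i))) (x (s (Suc i)) - x (s i)))
    \<longlonglongrightarrow> (\<Sum>i<n. blinfun_apply (tree_limit w (s i)) (x (s (Suc i)) - x (s i)))"
    by (intro tendsto_sum blinfun.tendsto tendsto_const tendsto_tree_limit[OF w q] s) auto
  fix m
  have "(\<Sum>i<n. blinfun_apply (w (Suc m) (dyadic_index (Suc m) (s i))) (x (s (Suc i)) - x (s i)))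
     - (\<Sum>i<n. blinfun_apply (w m (dyadic_index m (s i))) (x (s (Suc i)) - x (s i)))
     = (\<Sum>i<n. blinfun_apply (w (Suc m) (dyadic_index (Suc m) (s i)) - w m (dyadic_index (Suc m) (s i) div 2))
           (x (s (Suc i)) - x (s i)))"
    using s by (simp add: sum_subtractf[symmetric] dyadic_index_Suc_div_2 blinfun.diff_left)
  also have "norm \<dots> \<le> (D * q ^ m) * X * (2 * t + 1) * (2 * (1 / 2) powr \<alpha>) ^ Suc m"
    by (rule riemann_sum_detail_le[OF P _ x \<alpha> X, where f = "\<lambda>j. w (Suc m) j - w m (j div 2)"])
      (use w in \<open>auto simp: dyadic_tree_def\<close>)
  also have "\<dots> = D * X * (2 * t + 1) * (2 * h) * (2 * h * q) ^ m"
    by (simp add: h power_mult_distrib mult_ac)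
  finally show "norm ((\<Sum>i<n. blinfun_apply (w (Suc m) (dyadic_index (Suc m) (s i))) (x (s (Suc i)) - x (s i)))
     - (\<Sum>i<n. blinfun_apply (w m (dyadic_index m (s i))) (x (s (Suc i)) - x (s i))))
     \<le> D * X * (2 * t + 1) * (2 * h) * (2 * h * q) ^ m" .
qed (use q rate h in auto)

text \<open>The level \<open>k\<close> is fixed first, uniformly over all partitions, and only then
  the mesh \<open>\<delta>\<close>, which may depend on the number of cells of that level.\<close>

lemma has_young_integral_tree_limit:
  fixes x :: "real \<Rightarrow> 'a::real_normed_vector" and w :: "nat \<Rightarrow> nat \<Rightarrow> 'a \<Rightarrow>\<^sub>L 'b::banach"
  assumes w: "dyadic_tree D q w" and M: "\<And>k j. norm (w k j) \<le> M" and q: "0 \<le> q" "q < 1"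
    and x: "\<And>s t. norm (x t - x s) \<le> X * \<bar>t - s\<bar> powr \<alpha>"
    and \<alpha>: "0 < \<alpha>" "\<alpha> \<le> 1" and X: "0 \<le> X" and h: "h = (1 / 2) powr \<alpha>" and rate: "2 * h * q < 1"
    and lim: "(\<lambda>k. \<Sum>j<dyadic_index k t. blinfun_apply (w k j) (x (real (Suc j) / 2 ^ k) - x (real j / 2 ^ k)))
        \<longlonglongrightarrow> J"
  shows "has_young_integral (tree_limit w) x 0 t J"
  unfolding has_young_integral_def
proof (intro allI impI)
  fix \<epsilon> :: real assume \<epsilon>: "0 < \<epsilon>"
  define C where "C = (D * X * (2 * t + 1) * (2 * h)) / (1 - 2 * h * q)"
  define Z where "Z k = (\<Sum>j<dyadic_index k t. blinfun_apply (w k j) (x (real (Suc j) / 2 ^ k) - x (real j / 2 ^ k)))" for k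
  have M0: "0 \<le> M" using M[of 0 0] norm_ge_zero order_trans by blast
  have h01: "0 < h" "h < 1"
    using \<alpha> gr_one_powr[of 2 \<alpha>] by (auto simp: h powr_divide)
  have "(\<lambda>k. C * (2 * h * q) ^ k) \<longlonglongrightarrow> 0"
    using h01 q rate by (intro tendsto_mult_right_zero LIMSEQ_power_zero) auto
  then have "\<forall>\<^sub>F k in sequentially. C * (2 * h * q) ^ k < \<epsilon> / 4"
    by (rule order_tendstoD) (use \<epsilon> in simp)
  moreover have "(\<lambda>k. M * X * h ^ k) \<longlonglongrightarrow> 0"
    using h01 by (intro tendsto_mult_right_zero LIMSEQ_power_zero) auto
  then have "\<forall>\<^sub>F k in sequentially. M * X * h ^ k < \<epsilon> / 4"
    by (rule order_tendstoD) (use \<epsilon> in simp)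
  moreover have "\<forall>\<^sub>F k in sequentially. norm (Z k - J) < \<epsilon> / 4"
    using tendstoD[OF lim, of "\<epsilon> / 4"] \<epsilon> by (simp add: dist_norm Z_def)
  ultimately have "\<forall>\<^sub>F k in sequentially. C * (2 * h * q) ^ k < \<epsilon> / 4 \<and> M * X * h ^ k < \<epsilon> / 4 \<and> norm (Z k - J) < \<epsilon> / 4"
    by eventually_elim auto
  then obtain k where k: "C * (2 * h * q) ^ k < \<epsilon> / 4" "M * X * h ^ k < \<epsilon> / 4" "norm (Z k - J) < \<epsilon> / 4"
    by (auto simp: eventually_sequentially)
  define c where "c = real (dyadic_index k t) * (2 * M * X)"
  have c: "0 \<le> c" using M0 X by (simp add: c_def)
  \<comment> \<open>Solves \<open>\<delta> powr \<alpha> = \<epsilon> / (4 * (c + 1))\<close>; the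
    added 1 covers \<open>c = 0\<close>.\<close>
  define \<delta> where "\<delta> = (\<epsilon> / (4 * (c + 1))) powr (1 / \<alpha>)"
  have \<delta>: "0 < \<delta>" using \<epsilon> c by (simp add: \<delta>_def)
  have "c * \<delta> powr \<alpha> = c * (\<epsilon> / (4 * (c + 1)))"
    using \<epsilon> c \<alpha> by (simp add: \<delta>_def powr_powr)
  also have "\<dots> < \<epsilon> / 4"
    using \<epsilon> c by (simp add: field_simps)
  finally have c\<delta>: "c * \<delta> powr \<alpha> < \<epsilon> / 4" .
  show "\<exists>\<delta>>0. \<forall>n s. is_partition 0 t n s \<and> (\<forall>i<n. s (Suc i) - s i < \<delta>) \<longrightarrow>
       norm ((\<Sum>i<n. blinfun_apply (tree_limit w (s i)) (x (s (Suc i)) - x (s i))) - J) < \<epsilon>"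
  proof (rule exI[of _ \<delta>], intro conjI allI impI)
    show "0 < \<delta>" by (rule \<delta>)
    fix n s assume "is_partition 0 t n s \<and> (\<forall>i<n. s (Suc i) - s i < \<delta>)"
    then have P: "is_partition 0 t n s" and mesh: "\<forall>i<n. s (Suc i) - s i < \<delta>" by auto
    define R where "R = (\<Sum>i<n. blinfun_apply (w k (dyadic_index k (s i))) (x (s (Suc i)) - x (s i)))"
    define V where "V = (\<Sum>i<n. blinfun_apply (tree_limit w (s i)) (x (s (Suc i)) - x (s i)))"
    have "norm (V - R) \<le> C * (2 * h * q) ^ k"
      using riemann_sum_tree_limit_dist[OF P w q x _ _ X h rate, where k = k] \<alpha>
      by (simp add: C_def R_def V_def)
    moreover have "norm (R - Z k) \<le> c * \<delta> powr \<alpha> + M * X * h ^ k"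
      using riemann_sum_dyadic_step_grid_dist[where f = "w k" and k = k, OF P mesh _ M x _ X] \<alpha> \<delta>
      by (simp add: R_def Z_def c_def h)
    moreover have "norm (V - J) \<le> norm (V - R) + norm (R - Z k) + norm (Z k - J)"
      by norm
    ultimately have "norm (V - J) < \<epsilon>"
      using k c\<delta> by linarith
    then show "norm ((\<Sum>i<n. blinfun_apply (tree_limit w (s i)) (x (s (Suc i)) - x (s i))) - J) < \<epsilon>"
      by (simp only: V_def)
  qed
qed

section \<open>Variation of limits of dyadic trees\<close>

text \<open>The left ends of separated intervals have strictly increasing cell indices, all below
  \<open>dyadic_index k T\<close>.\<close>

lemma card_separated_intervals_le:
  assumes P: "is_partition 0 T n s"
  shows "real (card {i. i < n \<and> dyadic_index k (s i) \<noteq> dyadic_index k (s (Suc i))}) \<le> 2 ^ k * T"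
proof -
  have T: "0 \<le> T" using is_partition_bounds[OF P, of n] by simp
  define I where "I = {i. i < n \<and> dyadic_index k (s i) \<noteq> dyadic_index k (s (Suc i))}"
  have less: "dyadic_index k (s i) < dyadic_index k (s j)" if "i \<in> I" "i < j" "j \<le> n" for i j
  proof -
    have "dyadic_index k (s i) < dyadic_index k (s (Suc i))"
      using that dyadic_index_mono[OF is_partition_mono[OF P, of i "Suc i"], of k] by (auto simp: I_def)
    also have "\<dots> \<le> dyadic_index k (s j)"
      using that by (intro dyadic_index_mono is_partition_mono[OF P]) auto
    finally show ?thesis .
  qed
  have "inj_on (\<lambda>i. dyadic_index k (s i)) I"
  proof (rule linorder_inj_onI)
    fix i j assume "i < j" "i \<in> I" "j \<in> I"
    then show "dyadic_index k (s i) \<noteq> dyadic_index k (s j)"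
      using less[of i j] by (auto simp: I_def)
  qed auto
  moreover have "(\<lambda>i. dyadic_index k (s i)) ` I \<subseteq> {..<dyadic_index k T}"
    using less[of _ n] P by (auto simp: I_def is_partition_def)
  ultimately have "card I \<le> card {..<dyadic_index k T}"
    by (intro card_inj_on_le) auto
  then have "real (card I) \<le> real (dyadic_index k T)" by simp
  also have "\<dots> \<le> 2 ^ k * T" by (rule dyadic_index_le[OF T])
  finally show ?thesis by (simp add: I_def)
qed

lemma tree_limit_dist_separated:
  fixes w :: "nat \<Rightarrow> nat \<Rightarrow> 'a::banach"
  assumes w: "dyadic_tree D q w" and M: "\<And>j. norm (w 0 j) \<le> M" and q: "0 < q" "q < 1"
    and st: "0 \<le> s" "0 \<le> t" and sep: "\<And>i. i < k \<Longrightarrow> dyadic_index i s = dyadic_index i t"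
  shows "norm (tree_limit w t - tree_limit w s) \<le> 2 * (M + D / (1 - q) / q) * q ^ k"
proof -
  have q0: "0 \<le> q" using q by simp
  have M0: "0 \<le> M" using M[of 0] norm_ge_zero order_trans by blast
  have D: "0 \<le> D"
    using w unfolding dyadic_tree_def by (metis mult.right_neutral norm_ge_zero order_trans power_0)
  have near: "norm (tree_limit w r - w i (dyadic_index i r)) \<le> D / (1 - q) * q ^ i" if "0 \<le> r" for r i
    by (rule tree_limit_dist[OF w q0 q(2) that])
  show ?thesis
  proof (cases k)
    case 0
    define a b where "a = D / (1 - q)" and "b = D / (1 - q) / q"
    have "a \<le> b"
      using q D by (simp add: a_def b_def divide_right_mono mult_left_le le_divide_eq)
    moreover have "norm (tree_limit w t - tree_limit w s) \<le> norm (tree_limit w t - w 0 (dyadic_index 0 t))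
        + norm (tree_limit w s - w 0 (dyadic_index 0 s)) + norm (w 0 (dyadic_index 0 t)) + norm (w 0 (dyadic_index 0 s))"
      by norm
    moreover have "norm (tree_limit w s - w 0 (dyadic_index 0 s)) \<le> a" "norm (tree_limit w t - w 0 (dyadic_index 0 t)) \<le> a"
      using near[OF st(1), of 0] near[OF st(2), of 0] by (simp_all add: a_def)
    ultimately have "norm (tree_limit w t - tree_limit w s) \<le> 2 * (M + b)"
      using M[of "dyadic_index 0 t"] M[of "dyadic_index 0 s"] by simp
    then have "norm (tree_limit w t - tree_limit w s) \<le> 2 * (M + D / (1 - q) / q)"
      by (simp only: b_def)
    with 0 show ?thesis by simp
  next
    case (Suc i)
    have "norm (tree_limit w t - tree_limit w s) \<le> norm (tree_limit w t - w i (dyadic_index i t))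
        + norm (tree_limit w s - w i (dyadic_index i t))"
      by norm
    also have "\<dots> \<le> 2 * (D / (1 - q) * q ^ i)"
      using near[OF st(1), of i] near[OF st(2), of i] sep[of i] Suc by simp
    also have "\<dots> = 2 * (D / (1 - q) / q) * q ^ k"
      using q Suc by simp
    also have "\<dots> \<le> 2 * (M + D / (1 - q) / q) * q ^ k"
      using q M0 by (intro mult_right_mono) auto
    finally show ?thesis .
  qed
qed

text \<open>An increment over \<open>[s i, s (Suc i)]\<close> is charged to the coarsest dyadic level that separates
  the two endpoints; at level \<open>k\<close> at most \<open>2 ^ k * T\<close> increments are charged.\<close>

lemma finite_p_variation_tree_limit:
  fixes w :: "nat \<Rightarrow> nat \<Rightarrow> 'a::banach"
  assumes w: "dyadic_tree D q w" and M: "\<And>j. norm (w 0 j) \<le> M" and q: "0 < q" "q < 1"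
    and p: "0 < p" and rate: "2 * q powr p < 1"
  shows "finite_p_variation p 0 T (tree_limit w)"
proof -
  define C where "C = 2 * (M + D / (1 - q) / q)"
  define r where "r = q powr p"
  have r: "0 < r" "2 * r < 1" using q rate by (auto simp: r_def)
  have M0: "0 \<le> M" using M[of 0] norm_ge_zero order_trans by blast
  have D: "0 \<le> D"
    using w unfolding dyadic_tree_def by (metis mult.right_neutral norm_ge_zero order_trans power_0)
  have C: "0 \<le> C" using M0 D q by (simp add: C_def)
  have "(\<Sum>i<n. norm (tree_limit w (s (Suc i)) - tree_limit w (s i)) powr p) \<le> C powr p * (T / (1 - 2 * r))"
    if P: "is_partition 0 T n s" for n s
  proof -
    have T: "0 \<le> T" using is_partition_bounds[OF P, of n] by simp
    have s: "0 \<le> s i" if "i \<le> n" for i using is_partition_bounds[OF P that] by simp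
    define \<kappa> where "\<kappa> i = (LEAST k. dyadic_index k (s i) \<noteq> dyadic_index k (s (Suc i)))" for i
    have sep: "dyadic_index (\<kappa> i) (s i) \<noteq> dyadic_index (\<kappa> i) (s (Suc i))" if "i < n" for i
    proof -
      have "s i < s (Suc i)" using P that by (simp add: is_partition_def)
      from dyadic_index_separates[OF s this] that
      obtain k where "dyadic_index k (s i) \<noteq> dyadic_index k (s (Suc i))" by auto
      then show ?thesis unfolding \<kappa>_def by (rule LeastI)
    qed
    have incr: "norm (tree_limit w (s (Suc i)) - tree_limit w (s i)) powr p \<le> C powr p * r ^ \<kappa> i" if "i < n" for i
    proof -
      have "norm (tree_limit w (s (Suc i)) - tree_limit w (s i)) \<le> C * q ^ \<kappa> i"
        unfolding C_def
        by (rule tree_limit_dist_separated[OF w M q s s]) (use that in \<open>auto simp: \<kappa>_def dest: not_less_Least\<close>)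
      then have "norm (tree_limit w (s (Suc i)) - tree_limit w (s i)) powr p \<le> (C * q ^ \<kappa> i) powr p"
        using p by (intro powr_mono2) auto
      also have "\<dots> = C powr p * r ^ \<kappa> i"
        using q C by (simp add: powr_mult r_def powr_power powr_realpow[symmetric] powr_powr mult.commute)
      finally show ?thesis .
    qed
    have "(\<Sum>i<n. r ^ \<kappa> i) = (\<Sum>k\<in>\<kappa> ` {..<n}. \<Sum>i\<in>{i \<in> {..<n}. \<kappa> i = k}. r ^ \<kappa> i)"
      by (rule sum.image_gen) simp
    also have "\<dots> \<le> (\<Sum>k\<in>\<kappa> ` {..<n}. T * (2 * r) ^ k)"
    proof (rule sum_mono)
      fix k
      have "(\<Sum>i\<in>{i \<in> {..<n}. \<kappa> i = k}. r ^ \<kappa> i) = real (card {i \<in> {..<n}. \<kappa> i = k}) * r ^ k"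
        by simp
      also have "\<dots> \<le> real (card {i. i < n \<and> dyadic_index k (s i) \<noteq> dyadic_index k (s (Suc i))}) * r ^ k"
        using sep r by (intro mult_right_mono of_nat_mono card_mono) auto
      also have "\<dots> \<le> (2 ^ k * T) * r ^ k"
        using r by (intro mult_right_mono card_separated_intervals_le[OF P]) auto
      finally show "(\<Sum>i\<in>{i \<in> {..<n}. \<kappa> i = k}. r ^ \<kappa> i) \<le> T * (2 * r) ^ k"
        by (simp add: power_mult_distrib mult_ac)
    qed
    also have "\<dots> = T * (\<Sum>k\<in>\<kappa> ` {..<n}. (2 * r) ^ k)"
      by (simp add: sum_distrib_left)
    \<comment> \<open>Each level occurs once in the image of \<open>\<kappa>\<close>, so the full
      geometric series bounds the sum without reference to the partition.\<close>
    also have "\<dots> \<le> T * (\<Sum>k. (2 * r) ^ k)"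
      using r T by (intro mult_left_mono sum_le_suminf summable_geometric) auto
    also have "\<dots> = T / (1 - 2 * r)"
      using r by (subst suminf_geometric) auto
    finally have "(\<Sum>i<n. r ^ \<kappa> i) \<le> T / (1 - 2 * r)" .
    then have "C powr p * (\<Sum>i<n. r ^ \<kappa> i) \<le> C powr p * (T / (1 - 2 * r))"
      by (intro mult_left_mono) auto
    moreover have "(\<Sum>i<n. norm (tree_limit w (s (Suc i)) - tree_limit w (s i)) powr p) \<le> (\<Sum>i<n. C powr p * r ^ \<kappa> i)"
      using incr by (intro sum_mono) auto
    ultimately show ?thesis by (simp add: sum_distrib_left)
  qed
  then show ?thesis
    unfolding finite_p_variation_def by (intro bdd_aboveI[of _ "C powr p * (T / (1 - 2 * r))"]) auto
qed

section \<open>The Euler scheme\<close>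

text \<open>The choice at \<open>j\<close> looks back at \<open>j - 1\<close> and at an arbitrary
  earlier index \<open>par j\<close>, hence dependent choice along \<open>less_than\<close>.
  Membership is part of \<open>P\<close> because \<open>sel\<close> starts from a point already in a
  value of \<open>F\<close>.\<close>

lemma euler_scheme_exists:
  fixes F :: "'b::real_normed_vector \<Rightarrow> ('a::real_normed_vector \<Rightarrow>\<^sub>L 'b) set" and dx :: "nat \<Rightarrow> 'a"
  assumes sel: "\<And>a b u. u \<in> F a \<Longrightarrow> \<exists>w\<in>F b. dist w u \<le> L * dist a b powr \<gamma>"
    and ne: "F \<xi> \<noteq> {}" and par: "\<And>j. j > 0 \<Longrightarrow> par j < j"
  shows "\<exists>z v. z 0 = \<xi> \<and> (\<forall>j. v j \<in> F (z j)) \<and> (\<forall>j. z (Suc j) = z j + blinfun_apply (v j) (dx j)) \<and>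
    (\<forall>j>0. dist (v j) (v (par j)) \<le> L * dist (z (par j)) (z j) powr \<gamma>)"
proof -
  define P where "P f j r \<longleftrightarrow> snd r \<in> F (fst r) \<and> 
     (if j = 0 then fst r = \<xi> else
      fst r = fst (f (j - 1)) + blinfun_apply (snd (f (j - 1))) (dx (j - 1)) \<and>
      (snd (f (par j)) \<in> F (fst (f (par j))) \<longrightarrow> 
      dist (snd r) (snd (f (par j))) \<le> L * dist (fst (f (par j))) (fst r) powr \<gamma>))"
    for f :: "nat \<Rightarrow> 'b \<times> ('a \<Rightarrow>\<^sub>L 'b)" and j r
  have "\<exists>f. \<forall>j. P f j (f j)"
  proof (rule dependent_wf_choice[OF wf_less_than])
    fix f g :: "nat \<Rightarrow> 'b \<times> ('a \<Rightarrow>\<^sub>L 'b)" and j r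
    assume "\<And>i. (i, j) \<in> less_than \<Longrightarrow> f i = g i"
    then show "P f j r = P g j r"
      using par[of j] by (auto simp: P_def)
  next
    fix j and f :: "nat \<Rightarrow> 'b \<times> ('a \<Rightarrow>\<^sub>L 'b)"
    assume IH: "\<And>i. (i, j) \<in> less_than \<Longrightarrow> P f i (f i)"
    show "\<exists>r. P f j r"
    proof (cases "j = 0")
      case True
      with ne show ?thesis by (auto simp: P_def)
    next
      case False
      then have "snd (f (par j)) \<in> F (fst (f (par j)))"
        using IH[of "par j"] par[of j] by (auto simp: P_def)
      then show ?thesis
        using sel[of "snd (f (par j))" "fst (f (par j))"
            "fst (f (j - 1)) + blinfun_apply (snd (f (j - 1))) (dx (j - 1))"] False
        by (auto simp: P_def)
    qed
  qed
  then obtain f where f: "\<And>j. P f j (f j)" by blast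
  show ?thesis
  proof (rule exI[of _ "fst \<circ> f"], rule exI[of _ "snd \<circ> f"], intro conjI allI impI)
    show "dist ((snd \<circ> f) j) ((snd \<circ> f) (par j)) 
      \<le> L * dist ((fst \<circ> f) (par j)) ((fst \<circ> f) j) powr \<gamma>" if "j > 0" for j
      using f[of j] f[of "par j"] that by (auto simp: P_def)
    show "(fst \<circ> f) (Suc j) = (fst \<circ> f) j + blinfun_apply ((snd \<circ> f) j) (dx j)" for j
      using f[of "Suc j"] by (auto simp: P_def)
    show "(fst \<circ> f) 0 = \<xi>"
      using f[of 0] by (auto simp: P_def)
    show "(snd \<circ> f) j \<in> F ((fst \<circ> f) j)" for j
      using f[of j] by (auto simp: P_def)
  qed
qed

text \<open>Downward induction on the level: halving a cell gives the recursion
  \<open>K \<mapsto> 2 K h q + L X h q\<close> for the constant in the defect bound, and since \<open>\<gamma> < 1\<close> the constant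
  \<open>A\<close> can be chosen before the estimate, without smallness of the time step.\<close>

lemma euler_scheme_estimate:
  fixes z :: "nat \<Rightarrow> 'b::real_normed_vector" and v :: "nat \<Rightarrow> 'a::real_normed_vector \<Rightarrow>\<^sub>L 'b"
    and x :: "real \<Rightarrow> 'a"
  assumes h: "0 < h" "h \<le> 1" and q: "0 < q" "q \<le> 1" and hq: "q = h powr \<gamma>"
    and x: "\<And>k j. norm (x (real (Suc j) / 2 ^ k) - x (real j / 2 ^ k)) \<le> X * h ^ k"
    and step: "\<And>j. z (Suc j) = z j + blinfun_apply (v j) (x (real (Suc j) / 2 ^ n) - x (real j / 2 ^ n))"
    and bdd: "\<And>j. norm (v j) \<le> M"
    and sel: "\<And>i e. norm (v ((2 * i + 1) * 2 ^ e) - v (2 * i * 2 ^ e))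
        \<le> L * norm (z ((2 * i + 1) * 2 ^ e) - z (2 * i * 2 ^ e)) powr \<gamma>"
    and nonneg: "0 \<le> X" "0 \<le> M" "0 \<le> L" "0 \<le> K" "0 < A" "0 < \<gamma>"
    and K: "2 * K * (h * q) + L * X * (h * q) \<le> K" and A: "M * X + K * A powr \<gamma> \<le> A"
    and n: "n = m + e"
  shows "norm (z (Suc j * 2 ^ e) - z (j * 2 ^ e)
            - blinfun_apply (v (j * 2 ^ e)) (x (real (Suc j) / 2 ^ m) - x (real j / 2 ^ m)))
         \<le> K * A powr \<gamma> * (h * q) ^ m" (is ?sewing)
    and "norm (z (Suc j * 2 ^ e) - z (j * 2 ^ e)) \<le> A * h ^ m" (is ?increment)
proof -
  define dx where "dx m j = x (real (Suc j) / 2 ^ m) - x (real j / 2 ^ m)" for m j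
  \<comment> \<open>Here \<open>A\<close> is fed back: a defect bound at any level yields the
    increment bound with the same \<open>A\<close>. The induction below uses this at the finer
    level.\<close>
  have incr: "norm (z' - z'') \<le> A * h ^ m"
    if "norm (z' - z'' - blinfun_apply (v i) (dx m j)) \<le> K * A powr \<gamma> * (h * q) ^ m" for z' z'' i j m
  proof -
    have "norm (blinfun_apply (v i) (dx m j)) \<le> norm (v i) * norm (dx m j)"
      by (rule norm_blinfun)
    also have "\<dots> \<le> M * (X * h ^ m)"
      using x[of j m] by (intro mult_mono bdd) (auto simp: dx_def nonneg)
    finally have 1: "norm (blinfun_apply (v i) (dx m j)) \<le> M * X * h ^ m" by simp
    have "(h * q) ^ m \<le> h ^ m"
      using h q by (intro power_mono) (auto simp: mult_left_le)
    then have "K * A powr \<gamma> * (h * q) ^ m \<le> K * A powr \<gamma> * h ^ m"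
      using nonneg by (intro mult_left_mono) auto
    then have "norm (z' - z'') \<le> M * X * h ^ m + K * A powr \<gamma> * h ^ m"
      using 1 that norm_triangle_sub[of "z' - z''" "blinfun_apply (v i) (dx m j)"] by linarith
    also have "\<dots> = (M * X + K * A powr \<gamma>) * h ^ m" by (simp add: algebra_simps)
    also have "\<dots> \<le> A * h ^ m"
      using A h by (intro mult_right_mono) auto
    finally show ?thesis .
  qed
  have main: "norm (z (Suc j * 2 ^ e) - z (j * 2 ^ e) - blinfun_apply (v (j * 2 ^ e)) (dx m j))
         \<le> K * A powr \<gamma> * (h * q) ^ m" if "n = m + e" for m e j
    using that
  proof (induction e arbitrary: m j)
    \<comment> \<open>On the finest grid the defect is zero, the increment being one Euler
      step.\<close>
    case 0
    then show ?case
      using step[of j] h q nonneg by (simp add: dx_def)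
  next
    case (Suc e)
    have IH: "norm (z (Suc j * 2 ^ e) - z (j * 2 ^ e) - blinfun_apply (v (j * 2 ^ e)) (dx (Suc m) j))
         \<le> K * A powr \<gamma> * (h * q) ^ Suc m" for j
      using Suc.IH[of "Suc m" j] Suc.prems by simp
    let ?a = "2 * j * 2 ^ e" and ?b = "(2 * j + 1) * 2 ^ e" and ?c = "(2 * j + 2) * 2 ^ e"
    have "norm (z ?b - z ?a) \<le> A * h ^ Suc m"
      using incr[OF IH[of "2 * j"]] by simp
    then have "norm (z ?b - z ?a) powr \<gamma> \<le> (A * h ^ Suc m) powr \<gamma>"
      using nonneg by (intro powr_mono2) auto
    also have "\<dots> = A powr \<gamma> * q ^ Suc m"
      using h nonneg by (simp add: powr_mult powr_power powr_realpow[symmetric] powr_powr hq mult.commute del: power_Suc)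
    finally have "L * norm (z ?b - z ?a) powr \<gamma> \<le> L * (A powr \<gamma> * q ^ Suc m)"
      using nonneg by (intro mult_left_mono) auto
    with sel[of j e] have dv: "norm (v ?b - v ?a) \<le> L * (A powr \<gamma> * q ^ Suc m)"
      by linarith
    have "norm (blinfun_apply (v ?b - v ?a) (dx (Suc m) (2 * j + 1))) 
        \<le> norm (v ?b - v ?a) * norm (dx (Suc m) (2 * j + 1))"
      by (rule norm_blinfun)
    also have "\<dots> \<le> L * (A powr \<gamma> * q ^ Suc m) * (X * h ^ Suc m)"
      using x[of "2 * j + 1" "Suc m"] nonneg q by (intro mult_mono dv) (auto simp: dx_def)
    finally have dvdx: "norm (blinfun_apply (v ?b - v ?a) (dx (Suc m) (2 * j + 1))) \<le> \<dots>" .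
    have dx: "dx m j = dx (Suc m) (2 * j) + dx (Suc m) (2 * j + 1)"
    proof -
      have "real (Suc j) / 2 ^ m = real (Suc (2 * j + 1)) / 2 ^ Suc m"
        "real j / 2 ^ m = real (2 * j) / 2 ^ Suc m"
        by (simp_all add: field_simps)
      then show ?thesis unfolding dx_def by simp
    qed
    \<comment> \<open>The defect is not additive: freezing \<open>v\<close> at \<open>?a\<close>
      instead of \<open>?b\<close> over the second half leaves a cross term, controlled because
      \<open>v ?b\<close> was chosen near the value at its parent \<open>?a\<close>.\<close>
    have eq: "z ?c - z ?a - blinfun_apply (v ?a) (dx m j)
       = (z ?b - z ?a - blinfun_apply (v ?a) (dx (Suc m) (2 * j)))
         + (z ?c - z ?b - blinfun_apply (v ?b) (dx (Suc m) (2 * j + 1)))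
         + blinfun_apply (v ?b - v ?a) (dx (Suc m) (2 * j + 1))"
      unfolding dx by (simp add: blinfun.add_right blinfun.diff_left)
    have "norm (z ?c - z ?a - blinfun_apply (v ?a) (dx m j))
       \<le> K * A powr \<gamma> * (h * q) ^ Suc m + K * A powr \<gamma> * (h * q) ^ Suc m 
         + L * (A powr \<gamma> * q ^ Suc m) * (X * h ^ Suc m)"
      unfolding eq
      using IH[of "2 * j"] IH[of "2 * j + 1"] dvdx
      by (intro norm_triangle_mono) auto
    also have "\<dots> = (2 * K * (h * q) + L * X * (h * q)) * (A powr \<gamma> * (h * q) ^ m)"
      by (simp add: algebra_simps power_mult_distrib)
    also have "\<dots> \<le> K * (A powr \<gamma> * (h * q) ^ m)"
      using h q nonneg by (intro mult_right_mono K) auto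
    finally show ?case by (simp add: algebra_simps)
  qed
  show ?sewing using main[OF n, of j] by (simp add: dx_def)
  show ?increment by (rule incr[OF main[OF n]])
qed

lemma multiplicity_2_odd_times_power: "multiplicity 2 ((2 * i + 1) * 2 ^ e :: nat) = e"
proof (rule multiplicity_eqI)
  show "\<not> 2 ^ Suc e dvd (2 * i + 1) * 2 ^ e"
    using dvd_times_right_cancel_iff[of "2 ^ e" 2 "2 * i + 1"] by (simp only: power_Suc) simp
qed simp

text \<open>The two regimes of the sampling index \<open>j * 2 ^ n div 2 ^ k\<close>: for
  \<open>k \<le> n\<close> the division is exact, beyond \<open>n\<close> it rounds down.\<close>

lemma mult_power_div_power:
  fixes j :: nat
  shows "j * 2 ^ (k + e) div 2 ^ k = j * 2 ^ e" "j * 2 ^ n div 2 ^ (n + e) = j div 2 ^ e"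
  by (simp_all add: power_add div_mult2_eq mult.left_commute)

text \<open>Beyond level \<open>n\<close> the trees sample the scheme of step \<open>1 / 2 ^ n\<close> by rounding down to its grid, so
  that trees for different \<open>n\<close> satisfy the same bounds at all levels.\<close>

lemma euler_dyadic_trees:
  fixes F :: "'b::real_normed_vector \<Rightarrow> ('a::real_normed_vector \<Rightarrow>\<^sub>L 'b) set" and x :: "real \<Rightarrow> 'a"
  assumes sel: "\<And>a b u. u \<in> F a \<Longrightarrow> \<exists>w\<in>F b. dist w u \<le> L * dist a b powr \<gamma>"
    and ne: "F \<xi> \<noteq> {}" and bdd: "\<And>a u. u \<in> F a \<Longrightarrow> norm u \<le> M"
    and h: "0 < h" "h \<le> 1" and q: "0 < q" "q \<le> 1" and hq: "q = h powr \<gamma>"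
    and x: "\<And>k j. norm (x (real (Suc j) / 2 ^ k) - x (real j / 2 ^ k)) \<le> X * h ^ k"
    and nonneg: "0 \<le> X" "0 \<le> M" "0 \<le> L" "0 \<le> K" "0 < A" "0 < \<gamma>"
    and K: "2 * K * (h * q) + L * X * (h * q) \<le> K" and A: "M * X + K * A powr \<gamma> \<le> A"
  shows "\<exists>\<zeta> w. (\<forall>k. \<zeta> k 0 = \<xi>) \<and> (\<forall>j. w n j \<in> F (\<zeta> n j)) \<and> (\<forall>k j. norm (w k j) \<le> M) \<and>
    dyadic_tree (L * A powr \<gamma>) q w \<and> dyadic_tree A h \<zeta> \<and>
    (\<forall>k j. k \<le> n \<longrightarrow> norm (\<zeta> k (Suc j) - \<zeta> k j
        - blinfun_apply (w k j) (x (real (Suc j) / 2 ^ k) - x (real j / 2 ^ k))) \<le> K * A powr \<gamma> * (h * q) ^ k) \<and>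
    (\<forall>k j. norm (\<zeta> k j) \<le> norm \<xi> + A * real j)"
proof -
  obtain z v where z0: "z 0 = \<xi>" and v: "\<And>j. v j \<in> F (z j)"
    and step: "\<And>j. z (Suc j) = z j + blinfun_apply (v j) (x (real (Suc j) / 2 ^ n) - x (real j / 2 ^ n))"
    and par: "\<And>j. j > 0 \<Longrightarrow> dist (v j) (v (j - 2 ^ multiplicity 2 j))
       \<le> L * dist (z (j - 2 ^ multiplicity 2 j)) (z j) powr \<gamma>"
    using euler_scheme_exists[of F L \<gamma> \<xi> "\<lambda>j. j - 2 ^ multiplicity 2 j"
        "\<lambda>j. x (real (Suc j) / 2 ^ n) - x (real j / 2 ^ n)", OF sel ne] by auto
  have par': "norm (v ((2 * i + 1) * 2 ^ e) - v (2 * i * 2 ^ e))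
        \<le> L * norm (z ((2 * i + 1) * 2 ^ e) - z (2 * i * 2 ^ e)) powr \<gamma>" for i e
  proof -
    \<comment> \<open>Subtracting this power of two clears the lowest set bit: the parent of an odd
      multiple of \<open>2 ^ e\<close> is the even multiple just below.\<close>
    have "(2 * i + 1) * 2 ^ e - 2 ^ multiplicity 2 ((2 * i + 1) * 2 ^ e) = 2 * i * 2 ^ e"
      unfolding multiplicity_2_odd_times_power by (simp add: algebra_simps)
    then show ?thesis
      using par[of "(2 * i + 1) * 2 ^ e"] by (simp add: dist_norm norm_minus_commute)
  qed
  note est = euler_scheme_estimate[OF h q hq x step bdd[OF v] par' nonneg K A]
  define \<zeta> where "\<zeta> k j = z (j * 2 ^ n div 2 ^ k)" for k j
  define w where "w k j = v (j * 2 ^ n div 2 ^ k)" for k j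
  have D: "0 \<le> L * A powr \<gamma>" using nonneg by simp
  have trees: "norm (w (Suc k) j - w k (j div 2)) \<le> L * A powr \<gamma> * q ^ k \<and>
      norm (\<zeta> (Suc k) j - \<zeta> k (j div 2)) \<le> A * h ^ k" for k j
  \<comment> \<open>Only at odd points of levels up to \<open>n\<close> can a sample differ from
    that of the parent; otherwise both read the scheme at the same index.\<close>
  proof (cases "k < n \<and> odd j")
    case True
    then obtain e i where n: "n = Suc k + e" and j: "j = 2 * i + 1"
      by (metis less_imp_Suc_add oddE add_Suc)
    have *: "j * 2 ^ n div 2 ^ Suc k = (2 * i + 1) * 2 ^ e" "j div 2 * 2 ^ n div 2 ^ k = 2 * i * 2 ^ e"
      using mult_power_div_power(1)[of j "Suc k" e] mult_power_div_power(1)[of i k "Suc e"]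
      by (simp_all add: n j)
    have \<zeta>: "norm (\<zeta> (Suc k) j - \<zeta> k (j div 2)) \<le> A * h ^ Suc k"
      unfolding \<zeta>_def * using est(2)[OF n, of "2 * i"] by simp
    have "norm (w (Suc k) j - w k (j div 2)) \<le> L * norm (\<zeta> (Suc k) j - \<zeta> k (j div 2)) powr \<gamma>"
      unfolding w_def \<zeta>_def * by (rule par')
    also have "\<dots> \<le> L * (A * h ^ Suc k) powr \<gamma>"
      using nonneg \<zeta> by (intro mult_left_mono powr_mono2) auto
    also have "\<dots> = L * A powr \<gamma> * q ^ Suc k"
      using h nonneg by (simp add: powr_mult powr_power powr_realpow[symmetric] powr_powr hq mult.commute del: power_Suc)
    also have "\<dots> \<le> L * A powr \<gamma> * q ^ k"
      using D q by (intro mult_left_mono power_decreasing) auto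
    finally have "norm (w (Suc k) j - w k (j div 2)) \<le> L * A powr \<gamma> * q ^ k" .
    moreover have "A * h ^ Suc k \<le> A * h ^ k"
      using h nonneg by (intro mult_left_mono power_decreasing) auto
    ultimately show ?thesis using \<zeta> by linarith
  next
    case False
    have "j * 2 ^ n div 2 ^ Suc k = j div 2 * 2 ^ n div 2 ^ k"
    proof (cases "k < n")
      case True
      with False obtain i where "j = 2 * i" by auto
      then show ?thesis by simp
    next
      case False
      then obtain e where "k = n + e" using le_Suc_ex[of n k] by auto
      then show ?thesis
        using mult_power_div_power(2)[of j n "Suc e"] mult_power_div_power(2)[of "j div 2" n e]
        by (simp add: div_mult2_eq)
    qed
    then show ?thesis using D nonneg h q by (simp add: \<zeta>_def w_def)
  qed
  \<comment> \<open>The factor \<open>h ^ k \<le> 1\<close> is given away; what counts is a bound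
    independent of \<open>n\<close>, from which subsequences are extracted.\<close>
  have bound: "norm (z (j * 2 ^ e)) \<le> norm \<xi> + A * real j" if "n = k + e" for j k e
  proof (induction j)
    case (Suc j)
    have "norm (z (Suc j * 2 ^ e) - z (j * 2 ^ e)) \<le> A * h ^ k"
      by (rule est(2)[OF that])
    also have "\<dots> \<le> A"
      using h nonneg by (simp add: mult_left_le power_le_one)
    finally show ?case
      using Suc norm_triangle_sub[of "z (Suc j * 2 ^ e)" "z (j * 2 ^ e)"] by (simp add: algebra_simps)
  qed (simp add: z0)
  show ?thesis
  proof (rule exI[of _ \<zeta>], rule exI[of _ w], intro conjI allI impI)
    show "\<zeta> k 0 = \<xi>" for k by (simp add: \<zeta>_def z0)
    show "w n j \<in> F (\<zeta> n j)" for j by (simp add: \<zeta>_def w_def v)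
    show "norm (w k j) \<le> M" for k j unfolding w_def by (rule bdd[OF v])
    show "dyadic_tree (L * A powr \<gamma>) q w" "dyadic_tree A h \<zeta>"
      using trees by (auto simp: dyadic_tree_def)
    show "norm (\<zeta> k (Suc j) - \<zeta> k j - blinfun_apply (w k j) (x (real (Suc j) / 2 ^ k) - x (real j / 2 ^ k)))
        \<le> K * A powr \<gamma> * (h * q) ^ k" if "k \<le> n" for k j
    proof -
      obtain e where n: "n = k + e" using \<open>k \<le> n\<close> le_Suc_ex by auto
      have "i * 2 ^ n div 2 ^ k = i * 2 ^ e" for i :: nat
        unfolding n by (rule mult_power_div_power)
      then show ?thesis unfolding \<zeta>_def w_def using est(1)[OF n, of j] by presburger
    qed
    show "norm (\<zeta> k j) \<le> norm \<xi> + A * real j" for k j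
    proof (cases "k \<le> n")
      case True
      then obtain e where n: "n = k + e" using le_Suc_ex by auto
      have "j * 2 ^ n div 2 ^ k = j * 2 ^ e" unfolding n by (rule mult_power_div_power)
      with bound[OF n, of j] show ?thesis by (simp add: \<zeta>_def)
    next
      case False
      then obtain e where k: "k = n + e" using le_Suc_ex[of n k] by auto
      have "\<zeta> k j = z (j div 2 ^ e)" unfolding \<zeta>_def k mult_power_div_power ..
      also have "norm \<dots> \<le> norm \<xi> + A * real (j div 2 ^ e)"
        using bound[of n 0 "j div 2 ^ e"] by simp
      also have "\<dots> \<le> norm \<xi> + A * real j"
        using nonneg by (intro add_left_mono mult_left_mono) auto
      finally show ?thesis .
    qed
  qed
qed

section \<open>Passage to the limit\<close>

text \<open>Rescaling by \<open>B k j + 1\<close> gives the common bound 1, so the diagonal argument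
  over the countable set of index pairs applies.\<close>

lemma pointwise_convergent_subsequence:
  fixes u :: "nat \<Rightarrow> nat \<Rightarrow> nat \<Rightarrow> 'a::{real_normed_vector, heine_borel}"
  assumes u: "\<And>n k j. norm (u n k j) \<le> B k j"
  shows "\<exists>r w. strict_mono (r :: nat \<Rightarrow> nat) \<and> (\<forall>k j. (\<lambda>n. u (r n) k j) \<longlonglongrightarrow> w k j)"
proof -
  have B: "0 \<le> B k j" for k j using u[of 0 k j] norm_ge_zero order_trans by blast
  define f where "f n = (\<lambda>(k, j). inverse (B k j + 1) *\<^sub>R u n k j)" for n
  have "norm (f n y) \<le> 1" for n y
    using u[of n "fst y" "snd y"] B[of "fst y" "snd y"] by (simp add: f_def case_prod_beta field_simps)
  then obtain r where r: "strict_mono (r :: nat \<Rightarrow> nat)" "\<And>y. \<exists>l. (\<lambda>n. f (r n) y) \<longlonglongrightarrow> l"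
    using function_convergent_subsequence[of "UNIV :: (nat \<times> nat) set" f 1]
    by (metis UNIV_I countableI_type)
  have "\<exists>l. (\<lambda>n. u (r n) k j) \<longlonglongrightarrow> l" for k j
  proof -
    obtain l where "(\<lambda>n. f (r n) (k, j)) \<longlonglongrightarrow> l" using r(2) by blast
    then have "(\<lambda>n. (B k j + 1) *\<^sub>R f (r n) (k, j)) \<longlonglongrightarrow> (B k j + 1) *\<^sub>R l"
      by (intro tendsto_intros)
    then show ?thesis using B[of k j] by (auto simp: f_def)
  qed
  then obtain w where "\<And>k j. (\<lambda>n. u (r n) k j) \<longlonglongrightarrow> w k j" by metis
  with r(1) show ?thesis by blast
qed

lemma affine_powr_le_self:
  fixes a b \<gamma> :: real
  assumes "0 \<le> a" "0 \<le> b" "0 < \<gamma>" "\<gamma> < 1"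
  obtains A where "0 < A" "a + b * A powr \<gamma> \<le> A"
proof
  \<comment> \<open>Chosen so that \<open>A = (a + b + 1) * A powr \<gamma>\<close>; since also
    \<open>1 \<le> A powr \<gamma>\<close>, the constant \<open>a\<close> is absorbed.\<close>
  define A where "A = (a + b + 1) powr (1 / (1 - \<gamma>))"
  show "0 < A" using assms by (simp add: A_def)
  have "1 \<le> A" using assms by (simp add: A_def ge_one_powr_ge_zero)
  then have 1: "1 \<le> A powr \<gamma>" using assms by (simp add: ge_one_powr_ge_zero)
  have "A powr (1 - \<gamma>) = a + b + 1" using assms by (simp add: A_def powr_powr)
  then have "A = (a + b + 1) * A powr \<gamma>"
    using \<open>0 < A\<close> powr_add[of A "1 - \<gamma>" \<gamma>] by simp
  moreover have "a * 1 \<le> a * A powr \<gamma>" using assms 1 by (intro mult_left_mono) auto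
  ultimately show "a + b * A powr \<gamma> \<le> A"
    using 1 unfolding distrib_right by linarith
qed

text \<open>Extending \<open>x\<close> by its end values keeps it Hoelder, since clamping is
  1-Lipschitz. The Euler scheme runs over all grid points \<open>j / 2 ^ n\<close>, also those
  beyond \<open>T\<close>.\<close>

lemma holder_clamp:
  fixes x :: "real \<Rightarrow> 'a::metric_space"
  assumes hol: "holder_wrt dist \<alpha> {0..T} x" and "0 \<le> T" "0 \<le> \<alpha>"
  obtains X where "0 \<le> X"
    "\<And>s t. dist (x (max 0 (min T t))) (x (max 0 (min T s))) \<le> X * \<bar>t - s\<bar> powr \<alpha>"
proof -
  obtain C where C: "\<And>a b. a \<in> {0..T} \<Longrightarrow> b \<in> {0..T} \<Longrightarrow> a \<noteq> b \<Longrightarrow> dist (x a) (x b) / dist a b powr \<alpha> \<le> C"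
    using hol unfolding holder_wrt_def bdd_above_def by blast
  have "dist (x (max 0 (min T t))) (x (max 0 (min T s))) \<le> max C 0 * \<bar>t - s\<bar> powr \<alpha>" for s t
  proof (cases "max 0 (min T t) = max 0 (min T s)")
    case False
    define a b where "a = max 0 (min T t)" and "b = max 0 (min T s)"
    have ab: "a \<in> {0..T}" "b \<in> {0..T}" "a \<noteq> b" "\<bar>a - b\<bar> \<le> \<bar>t - s\<bar>"
      using False \<open>0 \<le> T\<close> by (auto simp: a_def b_def max_def min_def)
    have "dist (x a) (x b) \<le> C * dist a b powr \<alpha>"
      using C[OF ab(1-3)] ab(3) by (simp add: divide_le_eq)
    also have "\<dots> \<le> max C 0 * \<bar>t - s\<bar> powr \<alpha>"
      using ab(4) \<open>0 \<le> \<alpha>\<close> by (intro mult_mono powr_mono2) (auto simp: dist_real_def)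
    finally show ?thesis by (simp add: a_def b_def)
  qed simp
  then show ?thesis using that[of "max C 0"] by auto
qed

text \<open>Partition points stay in \<open>{a..b}\<close>; this carries integrals against the
  extended path back to \<open>x\<close>.\<close>

lemma has_young_integral_cong:
  assumes "has_young_integral v x a b I" "\<And>t. t \<in> {a..b} \<Longrightarrow> x t = y t"
  shows "has_young_integral v y a b I"
proof -
  have eq: "(\<Sum>i<n. blinfun_apply (v (s i)) (y (s (Suc i)) - y (s i))) = (\<Sum>i<n. blinfun_apply (v (s i)) (x (s (Suc i)) - x (s i)))"
    if P: "is_partition a b n s" for n s
  proof (rule sum.cong)
    fix i assume "i \<in> {..<n}"
    then have "s i \<in> {a..b}" "s (Suc i) \<in> {a..b}"
      using is_partition_bounds[OF P, of i] is_partition_bounds[OF P, of "Suc i"] by auto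
    then show "blinfun_apply (v (s i)) (y (s (Suc i)) - y (s i)) = blinfun_apply (v (s i)) (x (s (Suc i)) - x (s i))"
      using assms(2) by simp
  qed simp
  show ?thesis
    unfolding has_young_integral_def
  proof (intro allI impI)
    fix \<epsilon> :: real assume "0 < \<epsilon>"
    then obtain \<delta> where "\<delta> > 0" and \<delta>: "\<And>n s. is_partition a b n s \<and> (\<forall>i<n. s (Suc i) - s i < \<delta>) \<Longrightarrow>
        norm ((\<Sum>i<n. blinfun_apply (v (s i)) (x (s (Suc i)) - x (s i))) - I) < \<epsilon>"
      using assms(1) unfolding has_young_integral_def by blast
    then show "\<exists>\<delta>>0. \<forall>n s. is_partition a b n s \<and> (\<forall>i<n. s (Suc i) - s i < \<delta>) \<longrightarrow>
        norm ((\<Sum>i<n. blinfun_apply (v (s i)) (y (s (Suc i)) - y (s i))) - I) < \<epsilon>"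
      using eq by (intro exI[of _ \<delta>]) simp
  qed
qed

text \<open>The defects of the \<open>N = dyadic_index k t\<close> cells add up to at most
  \<open>N * (C * r ^ k)\<close>, and \<open>N \<le> 2 ^ k * t\<close> makes this of order
  \<open>(2 * r) ^ k\<close>.\<close>

lemma dyadic_grid_sums_tendsto:
  fixes \<zeta> :: "nat \<Rightarrow> nat \<Rightarrow> 'b::banach" and y :: "nat \<Rightarrow> nat \<Rightarrow> 'b"
  assumes \<zeta>: "dyadic_tree D h \<zeta>" and h: "0 \<le> h" "h < 1" and t: "0 \<le> t"
    and \<zeta>0: "\<And>k. \<zeta> k 0 = \<xi>" and r: "0 \<le> r" "2 * r < 1" and C: "0 \<le> C"
    and sewing: "\<And>k j. norm (\<zeta> k (Suc j) - \<zeta> k j - y k j) \<le> C * r ^ k"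
  shows "(\<lambda>k. \<Sum>j<dyadic_index k t. y k j) \<longlonglongrightarrow> tree_limit \<zeta> t - \<xi>"
proof -
  have diff: "norm (\<zeta> k N - \<xi> - (\<Sum>j<N. y k j)) \<le> real N * (C * r ^ k)" for k N
  proof -
    have "\<zeta> k N - \<xi> - (\<Sum>j<N. y k j) = (\<Sum>j<N. \<zeta> k (Suc j) - \<zeta> k j - y k j)"
      by (simp add: sum_subtractf[of _ "y k"] sum_lessThan_telescope \<zeta>0)
    also have "norm \<dots> \<le> (\<Sum>j<N. C * r ^ k)"
      by (intro sum_norm_le sewing)
    finally show ?thesis by simp
  qed
  have bound: "norm ((\<zeta> k (dyadic_index k t) - \<xi>) - (\<Sum>j<dyadic_index k t. y k j)) \<le> t * C * (2 * r) ^ k" for k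
  proof -
    have "real (dyadic_index k t) * (C * r ^ k) \<le> (2 ^ k * t) * (C * r ^ k)"
      using C r by (intro mult_right_mono dyadic_index_le[OF t]) auto
    with diff[of k "dyadic_index k t"] show ?thesis
      by (simp add: power_mult_distrib mult_ac)
  qed
  have lim0: "(\<lambda>k. t * C * (2 * r) ^ k) \<longlonglongrightarrow> 0"
    using r by (intro tendsto_mult_right_zero LIMSEQ_power_zero) auto
  have "(\<lambda>k. (\<zeta> k (dyadic_index k t) - \<xi>) - (\<Sum>j<dyadic_index k t. y k j)) \<longlonglongrightarrow> 0"
    by (rule Lim_null_comparison[OF _ lim0]) (use bound in simp)
  moreover have "(\<lambda>k. \<zeta> k (dyadic_index k t) - \<xi>) \<longlonglongrightarrow> tree_limit \<zeta> t - \<xi>"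
    by (intro tendsto_intros tendsto_tree_limit[OF \<zeta> h t])
  ultimately show ?thesis
    by (rule Lim_transform2[rotated])
qed

theorem theorem1p1:
  fixes T \<alpha> \<gamma> :: real
    and x :: "real \<Rightarrow> real ^ 'l"
    and F :: "real ^ 'd \<Rightarrow> ((real ^ 'l) \<Rightarrow>\<^sub>L (real ^ 'd)) set"
  assumes "T > 0"
    and "1 / 2 < \<alpha>" and "\<alpha> \<le> 1"
    and "holder_wrt dist \<alpha> {0..T} x"
    and "1 / \<alpha> - 1 < \<gamma>" and "\<gamma> < 1"
    and "\<And>a. F a \<noteq> {}" and "\<And>a. compact (F a)"
    and "bounded (\<Union>a. F a)"
    and "holder_wrt hausdorff_dist \<gamma> UNIV F"
  shows "\<forall>\<xi>. \<exists>z v. young_inclusion_solution T \<alpha> x F \<xi> z v"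
proof
  fix \<xi>
  have \<alpha>: "0 < \<alpha>" and \<gamma>: "0 < \<gamma>" and \<alpha>\<gamma>: "1 - \<alpha> < \<alpha> * \<gamma>"
  proof -
    show \<alpha>: "0 < \<alpha>" using assms(2) by simp
    show "0 < \<gamma>" using assms(3,5) \<alpha> by (smt (verit) le_divide_eq_1_pos)
    show "1 - \<alpha> < \<alpha> * \<gamma>" using assms(5) \<alpha> by (simp add: field_simps)
  qed
  obtain L where L: "0 \<le> L"
    and sel: "\<And>a b u. u \<in> F a \<Longrightarrow> \<exists>w\<in>F b. dist w u \<le> L * dist a b powr \<gamma>"
    using holder_selection[OF assms(7,8,10)] by metis
  obtain M where M: "0 \<le> M" "\<And>a u. u \<in> F a \<Longrightarrow> norm u \<le> M"
    using assms(9) unfolding bounded_pos by (meson UN_I UNIV_I less_imp_le)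
  define y where "y t = x (max 0 (min T t))" for t
  obtain X where X: "0 \<le> X" and y: "\<And>s t. norm (y t - y s) \<le> X * \<bar>t - s\<bar> powr \<alpha>"
    using holder_clamp[OF assms(4)] assms(1) \<alpha> unfolding y_def dist_norm by (metis less_imp_le)
  define h where "h = (1 / 2) powr \<alpha>"
  define q where "q = h powr \<gamma>"
  have h: "0 < h" "h < 1" using \<alpha> gr_one_powr[of 2 \<alpha>] by (auto simp: h_def powr_divide)
  have q: "0 < q" "q < 1" using h \<gamma> powr_less_mono2[of \<gamma> h 1] by (auto simp: q_def)
  \<comment> \<open>The hypothesis \<open>1 / \<alpha> - 1 < \<gamma>\<close> says precisely that
    this exponent exceeds 1.\<close>
  have "h * q = (1 / 2) powr (\<alpha> + \<alpha> * \<gamma>)"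
    by (simp add: h_def q_def powr_powr powr_add)
  also have "\<dots> < (1 / 2) powr 1"
    using \<alpha>\<gamma> by (intro powr_less_mono') auto
  finally have rate: "2 * (h * q) < 1" by simp
  have grid: "norm (y (real (Suc j) / 2 ^ k) - y (real j / 2 ^ k)) \<le> X * h ^ k" for k j
  proof -
    have "\<bar>real (Suc j) / 2 ^ k - real j / 2 ^ k\<bar> = 1 / 2 ^ k"
      by (simp add: diff_divide_distrib[symmetric])
    then show ?thesis
      using y[of "real (Suc j) / 2 ^ k" "real j / 2 ^ k"] by (simp only: half_power_powr h_def)
  qed
  \<comment> \<open>The fixed point of \<open>K \<mapsto> 2 * K * (h * q) + L * X * (h * q)\<close>,
    nonnegative by \<open>rate\<close>.\<close>
  define K where "K = L * X * (h * q) / (1 - 2 * (h * q))"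
  have K0: "0 \<le> K" using L X h q rate by (simp add: K_def)
  have "K * (1 - 2 * (h * q)) = L * X * (h * q)" using rate by (simp add: K_def)
  then have K: "2 * K * (h * q) + L * X * (h * q) \<le> K" by (simp add: algebra_simps)
  obtain A where A: "0 < A" "M * X + K * A powr \<gamma> \<le> A"
    using affine_powr_le_self[of "M * X" K \<gamma>] M X K0 \<gamma> assms(6) by auto
  define D where "D = L * A powr \<gamma>"
  define C where "C = K * A powr \<gamma>"
  have C: "0 \<le> C" using K0 by (simp add: C_def)
  define \<Phi> where "\<Phi> n \<zeta> w \<longleftrightarrow> (\<forall>k. \<zeta> k 0 = \<xi>) \<and> (\<forall>j. w n j \<in> F (\<zeta> n j)) \<and> (\<forall>k j. norm (w k j) \<le> M) \<and>
      dyadic_tree D q w \<and> dyadic_tree A h \<zeta> \<and>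
      (\<forall>k j. k \<le> n \<longrightarrow> norm (\<zeta> k (Suc j) - \<zeta> k j
        - blinfun_apply (w k j) (y (real (Suc j) / 2 ^ k) - y (real j / 2 ^ k))) \<le> C * (h * q) ^ k) \<and>
      (\<forall>k j. norm (\<zeta> k j) \<le> norm \<xi> + A * real j)" for n \<zeta> w
  have "\<exists>\<zeta> w. \<Phi> n \<zeta> w" for n
    unfolding \<Phi>_def C_def D_def
  proof (rule euler_dyadic_trees)
    show "\<exists>w\<in>F b. dist w u \<le> L * dist a b powr \<gamma>" if "u \<in> F a" for a b u
      using that by (rule sel)
    show "norm u \<le> M" if "u \<in> F a" for a u
      using that by (rule M(2))
    show "norm (y (real (Suc j) / 2 ^ k) - y (real j / 2 ^ k)) \<le> X * h ^ k" for k j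
      by (rule grid)
  qed (fact h(1) less_imp_le[OF h(2)] q(1) less_imp_le[OF q(2)] q_def X M(1) L K0 A K \<gamma> assms(7))+
  then obtain \<zeta> w where \<Phi>: "\<And>n. \<Phi> n (\<zeta> n) (w n)" by metis
  have tree0: "\<zeta> n k 0 = \<xi>" and mem: "w n n j \<in> F (\<zeta> n n j)"
    and wM: "norm (w n k j) \<le> M"
    and wtree: "dyadic_tree D q (w n)" and \<zeta>tree: "dyadic_tree A h (\<zeta> n)"
    and sewing: "k \<le> n \<Longrightarrow> norm (\<zeta> n k (Suc j) - \<zeta> n k j
        - blinfun_apply (w n k j) (y (real (Suc j) / 2 ^ k) - y (real j / 2 ^ k))) \<le> C * (h * q) ^ k"
    and \<zeta>B: "norm (\<zeta> n k j) \<le> norm \<xi> + A * real j" for n k j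
    using \<Phi>[of n] unfolding \<Phi>_def by blast+
  \<comment> \<open>Extract first for \<open>w\<close>, then inside that subsequence for
    \<open>\<zeta>\<close>, whose bound depends on \<open>j\<close> but not on
    \<open>n\<close>.\<close>
  obtain r1 w' where r1: "strict_mono r1" and lim1: "\<And>k j. (\<lambda>n. w (r1 n) k j) \<longlonglongrightarrow> w' k j"
    using pointwise_convergent_subsequence[of w "\<lambda>_ _. M", OF wM] by blast
  obtain r2 \<zeta>' where r2: "strict_mono r2" and lim2: "\<And>k j. (\<lambda>n. \<zeta> (r1 (r2 n)) k j) \<longlonglongrightarrow> \<zeta>' k j"
    using pointwise_convergent_subsequence[of "\<lambda>n. \<zeta> (r1 n)" "\<lambda>_ j. norm \<xi> + A * real j", OF \<zeta>B] by blast
  define r where "r n = r1 (r2 n)" for n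
  have r: "strict_mono r" using r1 r2 by (simp add: r_def strict_mono_def)
  have \<zeta>lim: "\<And>k j. (\<lambda>n. \<zeta> (r n) k j) \<longlonglongrightarrow> \<zeta>' k j"
    using lim2 by (simp add: r_def)
  have wlim: "\<And>k j. (\<lambda>n. w (r n) k j) \<longlonglongrightarrow> w' k j"
    using LIMSEQ_subseq_LIMSEQ[OF lim1 r2] by (simp add: r_def o_def)
  have w'tree: "dyadic_tree D q w'" by (rule dyadic_tree_limit_point[OF wtree wlim])
  have \<zeta>'tree: "dyadic_tree A h \<zeta>'" by (rule dyadic_tree_limit_point[OF \<zeta>tree \<zeta>lim])
  have w'M: "norm (w' k j) \<le> M" for k j
    by (rule Lim_bounded[OF tendsto_norm[OF wlim]]) (use wM in auto)
  have \<zeta>'0: "\<zeta>' k 0 = \<xi>" for k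
    using \<zeta>lim[of k 0] by (simp add: tree0 LIMSEQ_const_iff)
  have sewing': "norm (\<zeta>' k (Suc j) - \<zeta>' k j
        - blinfun_apply (w' k j) (y (real (Suc j) / 2 ^ k) - y (real j / 2 ^ k))) \<le> C * (h * q) ^ k" for k j
  proof (rule Lim_bounded)
    show "(\<lambda>n. norm (\<zeta> (r n) k (Suc j) - \<zeta> (r n) k j
        - blinfun_apply (w (r n) k j) (y (real (Suc j) / 2 ^ k) - y (real j / 2 ^ k))))
      \<longlonglongrightarrow> norm (\<zeta>' k (Suc j) - \<zeta>' k j
        - blinfun_apply (w' k j) (y (real (Suc j) / 2 ^ k) - y (real j / 2 ^ k)))"
      by (intro tendsto_norm tendsto_diff blinfun.tendsto tendsto_const \<zeta>lim wlim)
    \<comment> \<open>The estimate at level \<open>k\<close> is available for schemes of level at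
      least \<open>k\<close>, and \<open>r n \<ge> n\<close>.\<close>
    show "\<forall>n\<ge>k. norm (\<zeta> (r n) k (Suc j) - \<zeta> (r n) k j
        - blinfun_apply (w (r n) k j) (y (real (Suc j) / 2 ^ k) - y (real j / 2 ^ k))) \<le> C * (h * q) ^ k"
      using sewing seq_suble[OF r] order_trans by blast
  qed
  define z where "z = tree_limit \<zeta>'"
  define v where "v = tree_limit w'"
  have member: "v t \<in> F (z t)" if t: "0 \<le> t" for t
  proof (rule selection_closed_graph[OF sel \<gamma>])
    have rtop: "filterlim r at_top sequentially" using r by (rule filterlim_subseq)
    show "closed (F (z t))" using assms(8) compact_imp_closed by blast
    show "w (r n) (r n) (dyadic_index (r n) t) \<in> F (\<zeta> (r n) (r n) (dyadic_index (r n) t))" for n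
      by (rule mem)
    show "(\<lambda>n. \<zeta> (r n) (r n) (dyadic_index (r n) t)) \<longlonglongrightarrow> z t"
      unfolding z_def using h
      by (intro tendsto_tree_limit_diagonal[OF \<zeta>tree \<zeta>'tree _ _ t \<zeta>lim rtop]) auto
    show "(\<lambda>n. w (r n) (r n) (dyadic_index (r n) t)) \<longlonglongrightarrow> v t"
      unfolding v_def using q
      by (intro tendsto_tree_limit_diagonal[OF wtree w'tree _ _ t wlim rtop]) auto
  qed
  have integral: "has_young_integral v x 0 t (z t - \<xi>)" if t: "t \<in> {0..T}" for t
  proof (rule has_young_integral_cong)
    have "(\<lambda>k. \<Sum>j<dyadic_index k t. blinfun_apply (w' k j) (y (real (Suc j) / 2 ^ k) - y (real j / 2 ^ k)))
        \<longlonglongrightarrow> z t - \<xi>"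
      unfolding z_def using h q t rate C
      by (intro dyadic_grid_sums_tendsto[OF \<zeta>'tree _ _ _ \<zeta>'0 _ _ _ sewing']) auto
    then show "has_young_integral v y 0 t (z t - \<xi>)"
      unfolding v_def using q \<alpha> assms(3) rate
      by (intro has_young_integral_tree_limit[OF w'tree w'M _ _ y _ _ X h_def]) auto
    show "y s = x s" if "s \<in> {0..t}" for s
      using that t by (simp add: y_def)
  qed
  \<comment> \<open>\<open>e\<close> is \<open>1 / p\<close>, the midpoint between
    \<open>1 - \<alpha>\<close> and \<open>\<alpha> * \<gamma>\<close>: exceeding the first gives
    \<open>\<alpha> + 1 / p > 1\<close>, staying below the second gives
    \<open>2 * q powr p < 1\<close>.\<close>
  define e where "e = (1 - \<alpha> + \<alpha> * \<gamma>) / 2"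
  have "\<alpha> * \<gamma> < 1" using assms(3,6) \<alpha> \<gamma> by (smt (verit) mult_le_one mult_less_cancel_left2)
  then have e: "1 - \<alpha> < e" "e < \<alpha> * \<gamma>" "0 < e" "e \<le> 1"
    using \<alpha>\<gamma> assms(2,3) by (auto simp: e_def)
  have "q powr (1 / e) = (1 / 2) powr (\<alpha> * \<gamma> / e)"
    by (simp add: q_def h_def powr_powr)
  also have "\<dots> < (1 / 2) powr 1"
    using e by (intro powr_less_mono') auto
  finally have "finite_p_variation (1 / e) 0 T v"
    unfolding v_def using q e by (intro finite_p_variation_tree_limit[OF w'tree w'M]) auto
  then have "\<exists>p\<ge>1. \<alpha> + 1 / p > 1 \<and> finite_p_variation p 0 T v"
    using e by (intro exI[of _ "1 / e"]) auto
  then have "young_inclusion_solution T \<alpha> x F \<xi> z v"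
    unfolding young_inclusion_solution_def using member integral
    by (metis add.commute atLeastAtMost_iff diff_add_cancel)
  then show "\<exists>z v. young_inclusion_solution T \<alpha> x F \<xi> z v" by blast
qed

end
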